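(* Let $N$ be even, $M=N/2$. For $0<\rho<1$ the AR(1) Karhunen--Loève transform $\mathbf{W}_N(\rho)$ factors as $$\mathbf{W}_N(\rho)=\mathbf{P}_N\begin{pmatrix}\mathbf{Q}^{(s)}_M\mathbf{C}^{\mathrm{II}}_M&\\&\mathbf{Q}^{(a)}_M\mathbf{C}^{\mathrm{IV}}_M\end{pmatrix}\mathbf{B}_N ,\qquad ( * )$$ where, for $x\in\{s,a\}$, $\mathbf{Q}^{(x)}_M$ is the orthogonal matrix whose rows are the unit eigenvectors, ordered by increasing eigenvalue, of $\mathbf{G}^{(x)}_M=\mathbf{D}^{(x)}_M+\rho(1-\rho)\,q^{(x)}(q^{(x)})^T$ (all objects are defined in the context). In the limit $\rho\to1$: (i) the rank-one terms $\rho(1-\rho)\,e_0e_0^T$ in the half-size blocks $\mathbf{T}^{(s)}_M,\mathbf{T}^{(a)}_M$, and the rank-one terms $\rho(1-\rho)\,q^{(x)}(q^{(x)})^T$ in $\mathbf{G}^{(s)}_M,\mathbf{G}^{(a)}_M$, vanish; (ii) the branch diagonals become $\mathbf{D}^{(s)}_M=\Lambda^{\mathrm{II}}_M$ and $\mathbf{D}^{(a)}_M=\Lambda^{\mathrm{IV}}_M$, which are already diagonal with ascending entries, so that $\mathbf{Q}^{(s)}_M=\mathbf{Q}^{(a)}_M=\mathbf{I}_M$; (iii) the factorization $( * )$ degenerates to $$\mathbf{W}_N=\mathbf{P}_N\begin{pmatrix}\mathbf{C}^{\mathrm{II}}_M&\\&\mathbf{C}^{\mathrm{IV}}_M\end{pmatrix}\mathbf{B}_N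 ,$$ which is precisely the classical Chen--Smith--Fralick factorization of the DCT-II (of order $N$). Thus Chen's algorithm is the degenerate endpoint of an exact $\rho$-parametric factorization of the AR(1) KLT.
   Context: All indices start at $0$; empty positions in block matrices are zero blocks. $\mathbf{R}_N(\rho)=[\rho^{|i-j|}]_{i,j=0}^{N-1}$ is the AR(1) covariance matrix, $\rho\in(0,1)$. Its Karhunen--Loève transform (KLT) $\mathbf{W}_N(\rho)$ is the orthogonal matrix whose rows are the unit eigenvectors of $\mathbf{R}_N(\rho)$, ordered by decreasing eigenvalue. Eigenvectors, and hence the rows of $\mathbf{W}_N(\rho)$ and of $\mathbf{Q}^{(s)}_M,\mathbf{Q}^{(a)}_M$, are determined only up to the overall sign of each row, and identities between eigenvector matrices are understood up to row signs. $\mathbf{C}^{\mathrm{II}}_M$ and $\mathbf{C}^{\mathrm{IV}}_M$ are the orthonormal DCT-II and DCT-IV matrices of order $M$: $[\mathbf{C}^{\mathrm{II}}_M]_{n,k}=\sqrt{2/M}\,\beta_n\cos\frac{\pi n(2k+1)}{2M}$ with $\beta_0=1/\sqrt2$ and $\beta_n=1$ otherwise, and $[\mathbf{C}^{\mathrm{IV}}_M]_{n,k}=\sqrt{2/M}\cos\frac{\pi(2n+1)(2k+1)}{4M}$, $n,k=0,\dots,M-1$. $\Lambda^{\mathrm{II}}_M=\mathrm{diag}_{n=0,\dots,M-1}\big(2-2\cos\frac{n\pi}{M}\big)$ and $\Lambda^{\mathrm{IV}}_M=\mathrm{diag}_{n=0,\dots,M-1}\big(2-2\cos\frac{(2n+1)\pi}{2M}\big)$.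 $\mathbf{L}^{\mathrm{II}}_M=(\mathbf{C}^{\mathrm{II}}_M)^T\Lambda^{\mathrm{II}}_M\mathbf{C}^{\mathrm{II}}_M$ and $\mathbf{L}^{\mathrm{IV}}_M=(\mathbf{C}^{\mathrm{IV}}_M)^T\Lambda^{\mathrm{IV}}_M\mathbf{C}^{\mathrm{IV}}_M$; these are the tridiagonal matrices with off-diagonal entries $-1$ and diagonals $(1,2,\dots,2,1)$ and $(1,2,\dots,2,3)$, respectively. $\mathbf{I}_M$ is the identity, $\mathbf{J}_M$ the counter-identity (order-reversal) matrix, $e_0=(1,0,\dots,0)^T$ of length $M$. $\mathbf{B}_N=\frac{1}{\sqrt2}\begin{pmatrix}\mathbf{I}_M&\mathbf{J}_M\\ \mathbf{I}_M&-\mathbf{J}_M\end{pmatrix}$. $\mathbf{P}_N$ is the interleaving permutation matrix, $[\mathbf{P}_N]_{2i,\,i}=[\mathbf{P}_N]_{2i+1,\,M+i}=1$ for $i=0,\dots,M-1$ and zero otherwise. With $\mathbf{T}_N(\rho)=(1-\rho^2)\mathbf{R}_N(\rho)^{-1}$, one has $\mathbf{B}_N\mathbf{T}_N(\rho)\mathbf{B}_N^T=\begin{pmatrix}\mathbf{T}^{(s)}_M&\\&\mathbf{T}^{(a)}_M\end{pmatrix}$, where $\mathbf{T}^{(s)}_M=\rho\mathbf{L}^{\mathrm{II}}_M+(1-\rho)^2\mathbf{I}_M+\rho(1-\rho)e_0e_0^T$ and $\mathbf{T}^{(a)}_M=\rho\mathbf{L}^{\mathrm{IV}}_M+(1-\rho)^2\mathbf{I}_M+\rho(1-\rho)e_0e_0^T$.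 Further, $\mathbf{G}^{(s)}_M=\mathbf{C}^{\mathrm{II}}_M\mathbf{T}^{(s)}_M(\mathbf{C}^{\mathrm{II}}_M)^T$ and $\mathbf{G}^{(a)}_M=\mathbf{C}^{\mathrm{IV}}_M\mathbf{T}^{(a)}_M(\mathbf{C}^{\mathrm{IV}}_M)^T$, which equal $\mathbf{D}^{(x)}_M+\rho(1-\rho)q^{(x)}(q^{(x)})^T$ for $x=s,a$ with $\mathbf{D}^{(s)}_M=\rho\Lambda^{\mathrm{II}}_M+(1-\rho)^2\mathbf{I}_M$, $\mathbf{D}^{(a)}_M=\rho\Lambda^{\mathrm{IV}}_M+(1-\rho)^2\mathbf{I}_M$, $q^{(s)}=\mathbf{C}^{\mathrm{II}}_Me_0$, $q^{(a)}=\mathbf{C}^{\mathrm{IV}}_Me_0$. *)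

theory Defs
  imports
    Complex_Main
    "Jordan_Normal_Form.Char_Poly"
    "Jordan_Normal_Form.Gauss_Jordan_Elimination"
begin

definition block_diag :: "real mat \<Rightarrow> real mat \<Rightarrow> real mat" where
  "block_diag A D = four_block_mat A (0\<^sub>m (dim_row A) (dim_col D)) (0\<^sub>m (dim_row D) (dim_col A)) D"

definition row_sign_eq :: "real mat \<Rightarrow> real mat \<Rightarrow> bool" where
  "row_sign_eq A B \<longleftrightarrow>
     (\<exists>\<sigma> :: nat \<Rightarrow> real. (\<forall>i. \<sigma> i \<in> {1, -1}) \<and> A = mat_diag (dim_row B) \<sigma> * B)"

text \<open>
  The library predicate \<open>orthogonal_mat\<close> only asks for pairwise orthogonal nonzero columns, so
  orthogonality in the usual sense (orthonormal rows) is written out. Repeated eigenvalues are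
  not excluded: they are listed with multiplicity in the weak order \<open>ord\<close>.
\<close>

definition ordered_eigenvector_mat :: "(real \<Rightarrow> real \<Rightarrow> bool) \<Rightarrow> real mat \<Rightarrow> real mat \<Rightarrow> bool" where
  "ordered_eigenvector_mat ord A Q \<longleftrightarrow>
     Q \<in> carrier_mat (dim_row A) (dim_row A) \<and>
     Q * transpose_mat Q = 1\<^sub>m (dim_row A) \<and>
     (\<exists>\<mu> :: nat \<Rightarrow> real.
        (\<forall>i < dim_row A. eigenvector A (row Q i) (\<mu> i)) \<and>
        (\<forall>i j. i < j \<and> j < dim_row A \<longrightarrow> ord (\<mu> i) (\<mu> j)))"

abbreviation increasing_eigenvector_mat :: "real mat \<Rightarrow> real mat \<Rightarrow> bool" where
  "increasing_eigenvector_mat \<equiv> ordered_eigenvector_mat (\<le>)"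

abbreviation decreasing_eigenvector_mat :: "real mat \<Rightarrow> real mat \<Rightarrow> bool" where
  "decreasing_eigenvector_mat \<equiv> ordered_eigenvector_mat (\<ge>)"

definition mat_tendsto :: "('a \<Rightarrow> real mat) \<Rightarrow> real mat \<Rightarrow> 'a filter \<Rightarrow> bool" where
  "mat_tendsto X A F \<longleftrightarrow>
     (\<forall>\<^sub>F t in F. X t \<in> carrier_mat (dim_row A) (dim_col A)) \<and>
     (\<forall>i < dim_row A. \<forall>j < dim_col A. ((\<lambda>t. X t $$ (i, j)) \<longlongrightarrow> A $$ (i, j)) F)"

text \<open>
  Since each \<open>X t\<close> is only determined up to row signs, the signs may be chosen separately
  for every \<open>t\<close>.
\<close>

definition mat_tendsto_upto_row_signs :: "('a \<Rightarrow> real mat) \<Rightarrow> real mat \<Rightarrow> 'a filter \<Rightarrow> bool" where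
  "mat_tendsto_upto_row_signs X A F \<longleftrightarrow>
     (\<exists>\<sigma> :: 'a \<Rightarrow> nat \<Rightarrow> real. (\<forall>t i. \<sigma> t i \<in> {1, -1}) \<and>
        mat_tendsto (\<lambda>t. mat_diag (dim_row A) (\<sigma> t) * X t) A F)"

definition AR1_cov :: "nat \<Rightarrow> real \<Rightarrow> real mat" where
  "AR1_cov N \<rho> = mat N N (\<lambda>(i, j). \<rho> ^ nat \<bar>int i - int j\<bar>)"

definition is_KLT :: "nat \<Rightarrow> real \<Rightarrow> real mat \<Rightarrow> bool" where
  "is_KLT N \<rho> W \<longleftrightarrow> decreasing_eigenvector_mat (AR1_cov N \<rho>) W"

text \<open>The AR(1) covariance is invertible for \<open>0 < \<rho> < 1\<close>; outside that range \<open>the\<close> may be unspecified.\<close>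

definition T_mat :: "nat \<Rightarrow> real \<Rightarrow> real mat" where
  "T_mat N \<rho> = (1 - \<rho>\<^sup>2) \<cdot>\<^sub>m the (mat_inverse (AR1_cov N \<rho>))"

definition DCT_II :: "nat \<Rightarrow> real mat" where
  "DCT_II M = mat M M (\<lambda>(n, k). sqrt (2 / real M) * (if n = 0 then 1 / sqrt 2 else 1) *
     cos (pi * real n * (2 * real k + 1) / (2 * real M)))"

definition DCT_IV :: "nat \<Rightarrow> real mat" where
  "DCT_IV M = mat M M (\<lambda>(n, k). sqrt (2 / real M) *
     cos (pi * (2 * real n + 1) * (2 * real k + 1) / (4 * real M)))"

definition Lambda_II :: "nat \<Rightarrow> real mat" where
  "Lambda_II M = mat_diag M (\<lambda>n. 2 - 2 * cos (real n * pi / real M))"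

definition Lambda_IV :: "nat \<Rightarrow> real mat" where
  "Lambda_IV M = mat_diag M (\<lambda>n. 2 - 2 * cos ((2 * real n + 1) * pi / (2 * real M)))"

definition L_II :: "nat \<Rightarrow> real mat" where
  "L_II M = transpose_mat (DCT_II M) * Lambda_II M * DCT_II M"

definition L_IV :: "nat \<Rightarrow> real mat" where
  "L_IV M = transpose_mat (DCT_IV M) * Lambda_IV M * DCT_IV M"

definition counter_id :: "nat \<Rightarrow> real mat" where
  "counter_id M = mat M M (\<lambda>(i, j). if i + j + 1 = M then 1 else 0)"

definition butterfly :: "nat \<Rightarrow> real mat" where
  "butterfly N = (let M = N div 2 in
     (1 / sqrt 2) \<cdot>\<^sub>m four_block_mat (1\<^sub>m M) (counter_id M) (1\<^sub>m M) (- counter_id M))"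

definition interleave :: "nat \<Rightarrow> real mat" where
  "interleave N = (let M = N div 2 in
     mat N N (\<lambda>(r, c). if \<exists>i < M. (r = 2 * i \<and> c = i) \<or> (r = 2 * i + 1 \<and> c = M + i)
                       then 1 else 0))"

definition outer_prod :: "real vec \<Rightarrow> real vec \<Rightarrow> real mat" where
  "outer_prod v w = mat (dim_vec v) (dim_vec w) (\<lambda>(i, j). v $ i * w $ j)"

definition rank_one_term :: "real \<Rightarrow> real vec \<Rightarrow> real mat" where
  "rank_one_term \<rho> v = (\<rho> * (1 - \<rho>)) \<cdot>\<^sub>m outer_prod v v"

definition T_s :: "nat \<Rightarrow> real \<Rightarrow> real mat" where
  "T_s M \<rho> = \<rho> \<cdot>\<^sub>m L_II M + (1 - \<rho>)\<^sup>2 \<cdot>\<^sub>m 1\<^sub>m M + rank_one_term \<rho> (unit_vec M 0)"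

definition T_a :: "nat \<Rightarrow> real \<Rightarrow> real mat" where
  "T_a M \<rho> = \<rho> \<cdot>\<^sub>m L_IV M + (1 - \<rho>)\<^sup>2 \<cdot>\<^sub>m 1\<^sub>m M + rank_one_term \<rho> (unit_vec M 0)"

definition G_s :: "nat \<Rightarrow> real \<Rightarrow> real mat" where
  "G_s M \<rho> = DCT_II M * T_s M \<rho> * transpose_mat (DCT_II M)"

definition G_a :: "nat \<Rightarrow> real \<Rightarrow> real mat" where
  "G_a M \<rho> = DCT_IV M * T_a M \<rho> * transpose_mat (DCT_IV M)"

definition D_s :: "nat \<Rightarrow> real \<Rightarrow> real mat" where
  "D_s M \<rho> = \<rho> \<cdot>\<^sub>m Lambda_II M + (1 - \<rho>)\<^sup>2 \<cdot>\<^sub>m 1\<^sub>m M"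

definition D_a :: "nat \<Rightarrow> real \<Rightarrow> real mat" where
  "D_a M \<rho> = \<rho> \<cdot>\<^sub>m Lambda_IV M + (1 - \<rho>)\<^sup>2 \<cdot>\<^sub>m 1\<^sub>m M"

definition q_s :: "nat \<Rightarrow> real vec" where
  "q_s M = DCT_II M *\<^sub>v unit_vec M 0"

definition q_a :: "nat \<Rightarrow> real vec" where
  "q_a M = DCT_IV M *\<^sub>v unit_vec M 0"

end

theory Submission
  imports Defs
begin

text \<open>
  The matrices \<open>T\<^sub>N\<close>, \<open>T\<^sup>(\<^sup>s\<^sup>)\<close>, \<open>T\<^sup>(\<^sup>a\<^sup>)\<close> and the Laplacians are tridiagonal Toeplitz up to their corner entries,
  so each half-size block has eigenvectors \<open>cos (\<theta> (k - M + 1/2))\<close> (symmetric) or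
  \<open>sin (\<theta> (k - M + 1/2))\<close> (antisymmetric), with eigenvalue \<open>1 + \<rho>\<^sup>2 - 2 \<rho> cos \<theta>\<close>, where \<open>\<theta>\<close> solves the boundary condition
  \<open>x\<^sub>-\<^sub>1 = \<rho> x\<^sub>0\<close>. By the intermediate value theorem there is such a \<open>\<theta>\<close> in every cell
  \<open>(r \<pi> / N, (r + 1) \<pi> / N)\<close>, symmetric for even \<open>r\<close> and antisymmetric for odd \<open>r\<close>. This exhausts both
  spectra, shows that they are simple and interlace, and turns the interleaving of the two branches
  into the global eigenvalue order. Since a simple ordered spectrum determines its orthonormal
  eigenvectors up to sign, the factorization follows. As \<open>\<rho> \<rightarrow> 1\<close> the rank-one terms are of size
  \<open>1 - \<rho>\<close> while the eigenvalues of each branch stay away from the other diagonal entries of \<open>D\<close>, so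
  the off-diagonal entries of \<open>Q\<close> tend to \<open>0\<close>.
\<close>

section \<open>Orthonormal eigenvector matrices\<close>

text \<open>The modes are centred at \<open>M - 1/2\<close>, the middle of a signal of length
  \<open>N = 2 * M\<close>. The cosine is even and the sine odd about that point, so the condition
  at the inner end of a half-size block holds at every frequency, and only the outer condition
  selects \<open>\<theta>\<close>. At the two ends of a cell the boundary function is
  \<open>(-1) ^ i\<close> times \<open>cos (a / 2) * (1 - \<rho>)\<close> and
  \<open>- sin (b / 2) * (1 + \<rho>)\<close>; for \<open>\<rho> < 1\<close> these have opposite
  signs, which gives the root. Within one branch the cells have width \<open>pi / (2 * M)\<close>
  but the frequencies \<open>\<omega> j\<close> have spacing \<open>pi / M\<close>. A cell therefore
  keeps a distance from every other \<open>\<omega> j\<close> that is independent of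
  \<open>\<rho>\<close>, and the limit needs no information about how \<open>\<theta>\<close> moves
  with \<open>\<rho>\<close>.\<close>

lemma orthogonal_transpose:
  assumes "(Q :: real mat) \<in> carrier_mat n n" "Q * transpose_mat Q = 1\<^sub>m n"
  shows "transpose_mat Q * Q = 1\<^sub>m n"
  using mat_mult_left_right_inverse[OF assms(1) _ assms(2)] assms(1) by simp

lemma mult_mat_diag_index:
  assumes "A \<in> carrier_mat n m" "i < n" "j < m"
  shows "(mat_diag n f * A) $$ (i, j) = f i * A $$ (i, j)"
    "(A * mat_diag m g) $$ (i, j) = A $$ (i, j) * g j"
  using assms by (simp_all add: mat_diag_mult_left mat_diag_mult_right)

lemma dim_mat_diag [simp]: "dim_row (mat_diag n f) = n" "dim_col (mat_diag n f) = n"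
  by (simp_all add: mat_diag_def)

lemma transpose_mat_diag [simp]: "transpose_mat (mat_diag n f) = mat_diag n f"
  by (rule eq_matI) (auto simp: mat_diag_def)

lemma row_mult_symmetric:
  assumes "(A :: real mat) \<in> carrier_mat n n" "transpose_mat A = A"
    and "Q \<in> carrier_mat m n" "i < m"
  shows "row (Q * A) i = A *\<^sub>v row Q i"
proof (rule eq_vecI)
  fix j assume "j < dim_vec (A *\<^sub>v row Q i)"
  then have j: "j < n" using assms by simp
  have "col A j = row A j" using assms j row_transpose[of j A] by simp
  then show "row (Q * A) i $ j = (A *\<^sub>v row Q i) $ j"
    using assms j by (simp add: comm_scalar_prod[of _ n])
qed (use assms in auto)

lemma eigenrows_iff:
  assumes "(A :: real mat) \<in> carrier_mat n n" "transpose_mat A = A" "Q \<in> carrier_mat n n"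
  shows "Q * A = mat_diag n \<mu> * Q \<longleftrightarrow> (\<forall>i<n. A *\<^sub>v row Q i = \<mu> i \<cdot>\<^sub>v row Q i)"
proof
  assume eq: "Q * A = mat_diag n \<mu> * Q"
  show "\<forall>i<n. A *\<^sub>v row Q i = \<mu> i \<cdot>\<^sub>v row Q i"
  proof (intro allI impI)
    fix i assume i: "i < n"
    have "A *\<^sub>v row Q i = row (mat_diag n \<mu> * Q) i"
      using row_mult_symmetric[OF assms i] eq by simp
    also have "\<dots> = \<mu> i \<cdot>\<^sub>v row Q i"
      using assms(3) i by (intro eq_vecI) (simp_all add: mat_diag_mult_left[OF assms(3)])
    finally show "A *\<^sub>v row Q i = \<mu> i \<cdot>\<^sub>v row Q i" .
  qed
next
  assume ev: "\<forall>i<n. A *\<^sub>v row Q i = \<mu> i \<cdot>\<^sub>v row Q i"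
  show "Q * A = mat_diag n \<mu> * Q"
  proof (rule eq_matI)
    fix i j assume "i < dim_row (mat_diag n \<mu> * Q)" "j < dim_col (mat_diag n \<mu> * Q)"
    then have ij: "i < n" "j < n" using assms by auto
    then have "(Q * A) $$ (i, j) = row (Q * A) i $ j" using assms by simp
    then show "(Q * A) $$ (i, j) = (mat_diag n \<mu> * Q) $$ (i, j)"
      using assms ij ev by (simp only: row_mult_symmetric[OF assms ij(1)])
        (simp add: mat_diag_mult_left[OF assms(3)] del: index_mult_mat_vec)
  qed (use assms in auto)
qed

text \<open>Spectral data without an order. With \<open>\<mu>\<close> explicit, the same predicate
  serves the increasing branches, their interleaving and the decreasing KLT, and the identity for
  \<open>Q * A\<close> is matrix algebra that survives conjugation and block operations.\<close>

definition eigenframe :: "nat \<Rightarrow> real mat \<Rightarrow> (nat \<Rightarrow> real) \<Rightarrow> real mat \<Rightarrow> bool" where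
  "eigenframe n A \<mu> Q \<longleftrightarrow> A \<in> carrier_mat n n \<and> transpose_mat A = A \<and>
     Q \<in> carrier_mat n n \<and> Q * transpose_mat Q = 1\<^sub>m n \<and> Q * A = mat_diag n \<mu> * Q"

text \<open>Orthonormal rows have norm 1, so the nonzero condition inside \<open>eigenvector\<close>
  is automatic.\<close>

lemma ordered_eigenvector_mat_iff:
  assumes A: "A \<in> carrier_mat n n" "transpose_mat A = A"
  shows "ordered_eigenvector_mat ord A Q \<longleftrightarrow>
    (\<exists>\<mu>. eigenframe n A \<mu> Q \<and> (\<forall>i j. i < j \<and> j < n \<longrightarrow> ord (\<mu> i) (\<mu> j)))"
proof -
  have nz: "row Q i \<noteq> 0\<^sub>v n" if "Q \<in> carrier_mat n n" "Q * transpose_mat Q = 1\<^sub>m n" "i < n" for i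
  proof
    assume "row Q i = 0\<^sub>v n"
    moreover have "row Q i \<bullet> row Q i = 1"
      using arg_cong[OF that(2), of "\<lambda>X. X $$ (i, i)"] that(1,3) by simp
    ultimately show False using that by simp
  qed
  have n: "dim_row A = n" using A by simp
  have "(\<forall>i<n. eigenvector A (row Q i) (\<mu> i)) \<longleftrightarrow> Q * A = mat_diag n \<mu> * Q"
    if Q: "Q \<in> carrier_mat n n" "Q * transpose_mat Q = 1\<^sub>m n" for \<mu>
  proof -
    have "eigenvector A (row Q i) (\<mu> i) \<longleftrightarrow> A *\<^sub>v row Q i = \<mu> i \<cdot>\<^sub>v row Q i" if "i < n" for i
      unfolding eigenvector_def n using nz[OF Q that] Q(1) that by auto
    then show ?thesis by (simp add: eigenrows_iff[OF A Q(1)])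
  qed
  then show ?thesis
    unfolding ordered_eigenvector_mat_def eigenframe_def n using A by meson
qed

text \<open>Two-sided squeeze: growth from the left gives \<open>i \<le> f i\<close>, and growth up
  to the last index gives \<open>f i + (n - 1 - i) \<le> f (n - 1) < n\<close>.\<close>

lemma strict_mono_selfmap_id:
  fixes f :: "nat \<Rightarrow> nat"
  assumes "\<And>i j. i < j \<Longrightarrow> j < n \<Longrightarrow> f i < f j" "\<And>i. i < n \<Longrightarrow> f i < n" "i < n"
  shows "f i = i"
proof -
  have ge: "i < n \<Longrightarrow> i \<le> f i" for i
  proof (induction i)
    case (Suc i)
    then have "i \<le> f i" by simp
    also have "f i < f (Suc i)" by (rule assms(1)) (use Suc.prems in auto)
    finally show ?case by simp
  qed simp
  have "i + d < n \<Longrightarrow> f i + d \<le> f (i + d)" for d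
  proof (induction d)
    case (Suc d)
    then have "f (i + d) < f (i + Suc d)" by (intro assms(1)) auto
    with Suc.IH Suc.prems show ?case by linarith
  qed simp
  from this[of "n - 1 - i"] have "f i + (n - 1 - i) \<le> f (n - 1)" using assms(3) by simp
  moreover have "f (n - 1) < n" by (rule assms(2)) (use assms(3) in simp)
  ultimately show ?thesis using ge[OF assms(3)] assms(3) by linarith
qed

text \<open>
  Between two frames, the transition matrix \<open>U = Q P\<^sup>T\<close> intertwines the diagonal forms, so row \<open>i\<close> of
  \<open>U\<close> has a single nonzero entry, in column \<open>f i\<close> say; the ordering makes \<open>f\<close> strictly increasing,
  hence the identity.
\<close>
lemma eigenframe_unique:
  assumes P: "eigenframe n A \<mu> P" and Q: "eigenframe n A \<nu> Q"
    and strict: "\<And>i j. i < j \<Longrightarrow> j < n \<Longrightarrow> \<mu> i \<noteq> \<mu> j \<and> \<not> ord (\<mu> j) (\<mu> i)"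
    and ordered: "\<And>i j. i < j \<Longrightarrow> j < n \<Longrightarrow> ord (\<nu> i) (\<nu> j)"
  shows "row_sign_eq Q P" "\<And>i. i < n \<Longrightarrow> \<nu> i = \<mu> i"
proof -
  define U where "U = Q * transpose_mat P"
  have c: "A \<in> carrier_mat n n" "P \<in> carrier_mat n n" "Q \<in> carrier_mat n n" "U \<in> carrier_mat n n"
      "transpose_mat A = A"
    using P Q by (auto simp: eigenframe_def U_def)
  have PP: "transpose_mat P * P = 1\<^sub>m n" and QQ: "Q * transpose_mat Q = 1\<^sub>m n"
    using P Q orthogonal_transpose by (auto simp: eigenframe_def)
  have "U * transpose_mat U = Q * (transpose_mat P * P) * transpose_mat Q"
    using c by (simp add: U_def transpose_mult[of _ n n _ n] assoc_mult_mat[of _ n n _ n _ n])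
  then have UU: "U * transpose_mat U = 1\<^sub>m n" using c PP QQ by simp
  have "A * transpose_mat P = transpose_mat P * mat_diag n \<mu>"
    using P c transpose_mult[OF c(2,1)] transpose_mult[OF mat_diag_dim[of n \<mu>] c(2)]
    by (simp add: eigenframe_def)
  note AP = this
  have QA: "Q * A = mat_diag n \<nu> * Q" using Q by (simp add: eigenframe_def)
  have Pt: "transpose_mat P \<in> carrier_mat n n" using c by simp
  have comm: "mat_diag n \<nu> * U = U * mat_diag n \<mu>"
    unfolding U_def
    using assoc_mult_mat[OF mat_diag_dim[of n \<nu>] c(3) Pt] assoc_mult_mat[OF c(3) c(1) Pt]
      assoc_mult_mat[OF c(3) Pt mat_diag_dim[of n \<mu>]]
    by (simp only: AP QA)
  have inter: "(\<nu> i - \<mu> j) * U $$ (i, j) = 0" if "i < n" "j < n" for i j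
  proof -
    have "\<nu> i * U $$ (i, j) = U $$ (i, j) * \<mu> j"
      using mult_mat_diag_index[OF c(4) that] by (metis comm)
    then show ?thesis by (simp add: algebra_simps)
  qed
  have rows: "(\<Sum>k<n. U $$ (i, k) * U $$ (j, k)) = (if i = j then 1 else 0)" if "i < n" "j < n" for i j
    using arg_cong[OF UU, of "\<lambda>X. X $$ (i, j)"] that c
    by (simp add: scalar_prod_def lessThan_atLeast0)
  have "\<exists>j<n. U $$ (i, j) \<noteq> 0" if "i < n" for i
  proof (rule ccontr)
    assume "\<not> (\<exists>j<n. U $$ (i, j) \<noteq> 0)"
    then have "(\<Sum>k<n. U $$ (i, k) * U $$ (i, k)) = 0" by (intro sum.neutral) simp
    then show False using rows[OF that that] by simp
  qed
  then obtain f where f: "\<And>i. i < n \<Longrightarrow> f i < n" "\<And>i. i < n \<Longrightarrow> U $$ (i, f i) \<noteq> 0" by metis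
  have \<nu>: "\<nu> i = \<mu> (f i)" if "i < n" for i using inter[of i "f i"] f that by simp
  have zero: "U $$ (i, j) = 0" if "i < n" "j < n" "j \<noteq> f i" for i j
    using inter[of i j] \<nu>[of i] strict[of j "f i"] strict[of "f i" j] that f(1)[of i]
    by (cases "j < f i") auto
  have single: "(\<Sum>k<n. U $$ (i, k) * U $$ (j, k)) = U $$ (i, f i) * U $$ (j, f i)"
    if "i < n" for i j
  proof -
    have "(\<Sum>k<n. U $$ (i, k) * U $$ (j, k)) = (\<Sum>k\<in>{f i}. U $$ (i, k) * U $$ (j, k))"
      by (rule sum.mono_neutral_right) (use that f zero in auto)
    then show ?thesis by simp
  qed
  \<comment> \<open>Two rows whose single nonzero entries share a column would have a nonzero inner
    product.\<close>
  have inj: "f i \<noteq> f j" if "i < j" "j < n" for i j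
    using single[of i j] rows[of i j] f(2)[of i] f(2)[of j] that by auto
  have f_id: "f i = i" if "i < n" for i
  proof (rule strict_mono_selfmap_id[of n])
    show "f i < f j" if "i < j" "j < n" for i j
    proof (rule ccontr)
      assume "\<not> f i < f j"
      then have "f j < f i" using inj[OF that] by simp
      then have "\<not> ord (\<mu> (f i)) (\<mu> (f j))" using strict f(1) that by auto
      then show False using ordered[OF that] \<nu> that by simp
    qed
  qed (use f that in auto)
  show "\<nu> i = \<mu> i" if "i < n" for i using \<nu>[OF that] f_id[OF that] by simp
  \<comment> \<open>\<open>row_sign_eq\<close> asks for signs at all natural indices, so those
    beyond the matrix get the value 1.\<close>
  define \<sigma> where "\<sigma> i = (if i < n then U $$ (i, i) else 1)" for i
  have sq: "U $$ (i, i) * U $$ (i, i) = 1" if "i < n" for i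
    using single[OF that, of i] rows[OF that that] f_id[OF that] by simp
  have "\<sigma> i \<in> {1, -1}" for i
    using sq[of i] by (auto simp: \<sigma>_def square_eq_1_iff)
  moreover have "U = mat_diag n \<sigma>"
    using c zero f_id by (intro eq_matI) (auto simp: mat_diag_def \<sigma>_def)
  moreover have "Q = U * P"
    using c PP by (simp add: U_def assoc_mult_mat[of _ n n _ n _ n])
  ultimately have "Q = mat_diag (dim_row P) \<sigma> * P" "\<forall>i. \<sigma> i \<in> {1, -1}" using c(2) by simp_all
  then show "row_sign_eq Q P" unfolding row_sign_eq_def by blast
qed

text \<open>Eigenvectors of a symmetric matrix for distinct eigenvalues are orthogonal, so it
  suffices to normalise explicit ones; no spectral theorem is invoked.\<close>

lemma eigenframe_exists:
  assumes A: "A \<in> carrier_mat n n" "transpose_mat A = A"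
    and v: "\<And>i. i < n \<Longrightarrow> v i \<in> carrier_vec n \<and> v i \<noteq> 0\<^sub>v n \<and> A *\<^sub>v v i = \<mu> i \<cdot>\<^sub>v v i"
    and distinct: "\<And>i j. i < j \<Longrightarrow> j < n \<Longrightarrow> \<mu> i \<noteq> \<mu> j"
  shows "\<exists>Q. eigenframe n A \<mu> Q"
proof -
  define Q where "Q = mat n n (\<lambda>(i, j). v i $ j / sqrt (v i \<bullet> v i))"
  have row: "row Q i = (1 / sqrt (v i \<bullet> v i)) \<cdot>\<^sub>v v i" if "i < n" for i
    using v[OF that] that by (intro eq_vecI) (auto simp: Q_def)
  have orth: "v i \<bullet> v j = 0" if "i < n" "j < n" "i \<noteq> j" for i j
  proof -
    have c: "v i \<in> carrier_vec n" "v j \<in> carrier_vec n" using v that by auto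
    have "\<mu> i * (v i \<bullet> v j) = (A *\<^sub>v v i) \<bullet> v j"
      using v that c by (simp add: smult_scalar_prod_distrib[of _ n])
    also have "\<dots> = v i \<bullet> (A *\<^sub>v v j)"
      using A c transpose_vec_mult_scalar[of A n n "v j" "v i"] by (metis comm_scalar_prod mult_mat_vec_carrier)
    also have "\<dots> = \<mu> j * (v i \<bullet> v j)"
      using v that c by (simp add: scalar_prod_smult_distrib[of _ n])
    finally have "(\<mu> i - \<mu> j) * (v i \<bullet> v j) = 0" by (simp add: algebra_simps)
    then show ?thesis using distinct[of i j] distinct[of j i] that by (cases "i < j") auto
  qed
  have pos: "v i \<bullet> v i > 0" if i: "i < n" for i
  proof -
    obtain k where "k < n" "v i $ k \<noteq> 0"
      using v[OF i] by (metis carrier_vecD eq_vecI index_zero_vec(1) index_zero_vec(2))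
    then show ?thesis
      using v[OF i] unfolding scalar_prod_def
      by (intro sum_pos2[of _ k]) (auto simp: not_sum_squares_lt_zero zero_less_mult_iff linorder_neq_iff)
  qed
  have "Q * transpose_mat Q = 1\<^sub>m n"
  proof (rule eq_matI)
    fix i j assume "i < dim_row (1\<^sub>m n)" "j < dim_col (1\<^sub>m n)"
    then have ij: "i < n" "j < n" by auto
    have c: "v i \<in> carrier_vec n" "v j \<in> carrier_vec n" using v ij by auto
    have "(Q * transpose_mat Q) $$ (i, j) = row Q i \<bullet> row Q j" using ij by (simp add: Q_def)
    also have "\<dots> = (v i \<bullet> v j) / (sqrt (v i \<bullet> v i) * sqrt (v j \<bullet> v j))"
      using c[THEN carrier_vecD] ij
      by (simp add: row)
    finally show "(Q * transpose_mat Q) $$ (i, j) = 1\<^sub>m n $$ (i, j)"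
      using orth[OF ij] pos[OF ij(1)] ij by (cases "i = j") (auto simp: less_imp_le)
  qed (auto simp: Q_def)
  moreover have "Q * A = mat_diag n \<mu> * Q"
  proof (subst eigenrows_iff[OF A])
    show "Q \<in> carrier_mat n n" by (simp add: Q_def)
    show "\<forall>i<n. A *\<^sub>v row Q i = \<mu> i \<cdot>\<^sub>v row Q i"
    proof (intro allI impI)
      fix i assume i: "i < n"
      define s where "s = 1 / sqrt (v i \<bullet> v i)"
      have "A *\<^sub>v (s \<cdot>\<^sub>v v i) = s \<cdot>\<^sub>v (A *\<^sub>v v i)"
        using v[OF i] by (intro mult_mat_vec[OF A(1)]) simp
      then show "A *\<^sub>v row Q i = \<mu> i \<cdot>\<^sub>v row Q i"
        unfolding row[OF i] s_def[symmetric] using v[OF i]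
        by (simp add: smult_smult_assoc mult.commute[of s])
    qed
  qed
  ultimately have "eigenframe n A \<mu> Q" using A by (auto simp: eigenframe_def Q_def)
  then show ?thesis by blast
qed

section \<open>Tridiagonal matrices and trigonometric bases\<close>

text \<open>
  The corner weights encode boundary conditions: a sequence with \<open>x\<^sub>-\<^sub>1 = \<alpha> x\<^sub>0\<close> and
  \<open>x\<^sub>n = \<beta> x\<^sub>n\<^sub>-\<^sub>1\<close> is mapped to \<open>b x\<^sub>k - r x\<^sub>k\<^sub>-\<^sub>1 - r x\<^sub>k\<^sub>+\<^sub>1\<close> in every row.
\<close>
definition tridiag :: "nat \<Rightarrow> real \<Rightarrow> real \<Rightarrow> real \<Rightarrow> real \<Rightarrow> real mat" where
  "tridiag n b r \<alpha> \<beta> = mat n n (\<lambda>(i, j).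
     (if i = j then b - (if i = 0 then r * \<alpha> else 0) - (if i + 1 = n then r * \<beta> else 0) else 0)
     - (if j = i + 1 then r else 0) - (if i = j + 1 then r else 0))"

lemma tridiag_carrier [simp]: "tridiag n b r \<alpha> \<beta> \<in> carrier_mat n n"
  "dim_row (tridiag n b r \<alpha> \<beta>) = n" "dim_col (tridiag n b r \<alpha> \<beta>) = n"
  by (simp_all add: tridiag_def)

lemma transpose_tridiag [simp]: "transpose_mat (tridiag n b r \<alpha> \<beta>) = tridiag n b r \<alpha> \<beta>"
  by (rule eq_matI) (auto simp: tridiag_def)

lemma tridiag_sum:
  fixes x :: "int \<Rightarrow> real"
  assumes "i < n" "x (-1) = \<alpha> * x 0" "x (int n) = \<beta> * x (int n - 1)"
  shows "(\<Sum>k<n. tridiag n b r \<alpha> \<beta> $$ (i, k) * x (int k)) =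
    b * x (int i) - r * x (int i - 1) - r * x (int i + 1)"
proof -
  define d where "d = b - (if i = 0 then r * \<alpha> else 0) - (if i + 1 = n then r * \<beta> else 0)"
  \<comment> \<open>For \<open>i = 0\<close> truncated subtraction makes \<open>i - 1\<close> equal
    to \<open>0\<close>, so the left neighbour is guarded by \<open>i > 0\<close>.\<close>
  have pred: "(i = k + 1) = (i > 0 \<and> k = i - 1)" for k by auto
  have "(\<Sum>k<n. tridiag n b r \<alpha> \<beta> $$ (i, k) * x (int k)) =
    (\<Sum>k<n. (if k = i then d * x (int i) else 0) - (if k = i + 1 then r * x (int i + 1) else 0)
      - (if k = i - 1 then (if i > 0 then r * x (int i - 1) else 0) else 0))"
    using assms(1) by (intro sum.cong refl) (auto simp: tridiag_def d_def pred of_nat_diff add.commute)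
  also have "\<dots> = d * x (int i) - (if i + 1 < n then r * x (int i + 1) else 0)
      - (if i > 0 then r * x (int i - 1) else 0)"
    using assms(1) by (simp add: sum_subtractf sum.delta del: sum.delta')
  also have "\<dots> = b * x (int i) - r * x (int i - 1) - r * x (int i + 1)"
  proof -
    have top: "r * x (int i + 1) = r * \<beta> * x (int i)" if "i + 1 = n"
      using assms(3) that by (auto simp: add.commute)
    show ?thesis
      using assms(1,2) top by (cases "i = 0"; cases "i + 1 = n") (auto simp: d_def algebra_simps)
  qed
  finally show ?thesis .
qed

text \<open>The eigenvalue depends only on \<open>b\<close>, \<open>r\<close> and \<open>c\<close>;
  the corner weights merely decide which solutions of the recurrence are admissible. Integer indices
  give meaning to the ghost values at \<open>-1\<close> and \<open>n\<close>.\<close>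

lemma tridiag_eigenvector:
  fixes x :: "int \<Rightarrow> real"
  assumes "x (-1) = \<alpha> * x 0" "x (int n) = \<beta> * x (int n - 1)"
    and "\<And>k. x (k - 1) + x (k + 1) = 2 * c * x k"
  shows "tridiag n b r \<alpha> \<beta> *\<^sub>v vec n (\<lambda>k. x (int k)) = (b - 2 * r * c) \<cdot>\<^sub>v vec n (\<lambda>k. x (int k))"
proof (rule eq_vecI)
  fix i assume "i < dim_vec ((b - 2 * r * c) \<cdot>\<^sub>v vec n (\<lambda>k. x (int k)))"
  then have i: "i < n" by simp
  have "(tridiag n b r \<alpha> \<beta> *\<^sub>v vec n (\<lambda>k. x (int k))) $ i =
      (\<Sum>k<n. tridiag n b r \<alpha> \<beta> $$ (i, k) * x (int k))"
    using i by (simp add: scalar_prod_def lessThan_atLeast0)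
  also have "\<dots> = b * x (int i) - r * (x (int i - 1) + x (int i + 1))"
    unfolding tridiag_sum[OF i assms(1,2)] by (simp add: algebra_simps)
  finally have eq: "(tridiag n b r \<alpha> \<beta> *\<^sub>v vec n (\<lambda>k. x (int k))) $ i =
      b * x (int i) - r * (x (int i - 1) + x (int i + 1))" .
  show "(tridiag n b r \<alpha> \<beta> *\<^sub>v vec n (\<lambda>k. x (int k))) $ i =
      ((b - 2 * r * c) \<cdot>\<^sub>v vec n (\<lambda>k. x (int k))) $ i"
    unfolding eq assms(3) using i by (simp add: algebra_simps)
qed simp

section \<open>The tridiagonal inverse of the AR(1) covariance\<close>

text \<open>Column \<open>j\<close> of the covariance decays geometrically on both sides of
  \<open>j\<close>. Its natural extension beyond the matrix satisfies both boundary conditions with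
  weight \<open>\<rho>\<close>, and the three-term operator annihilates it everywhere except at
  \<open>j\<close>.\<close>

lemma AR1_precision:
  "tridiag N (1 + \<rho>\<^sup>2) \<rho> \<rho> \<rho> * AR1_cov N \<rho> = (1 - \<rho>\<^sup>2) \<cdot>\<^sub>m 1\<^sub>m N"
proof (rule eq_matI)
  fix i j assume "i < dim_row ((1 - \<rho>\<^sup>2) \<cdot>\<^sub>m 1\<^sub>m N)" "j < dim_col ((1 - \<rho>\<^sup>2) \<cdot>\<^sub>m (1\<^sub>m N :: real mat))"
  then have ij: "i < N" "j < N" by auto
  define x where "x k = \<rho> ^ nat \<bar>k - int j\<bar>" for k
  have step: "nat \<bar>k - int j\<bar> = Suc (nat \<bar>k + 1 - int j\<bar>)" if "k < int j" for k
    using that by simp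
  have step': "nat \<bar>k - int j\<bar> = Suc (nat \<bar>k - 1 - int j\<bar>)" if "k > int j" for k
    using that by simp
  have "x (-1) = \<rho> * x 0" "x (int N) = \<rho> * x (int N - 1)"
    using step[of "-1"] step'[of "int N"] ij by (simp_all add: x_def)
  note sum = tridiag_sum[OF ij(1) this, of "1 + \<rho>\<^sup>2" \<rho>]
  have "(tridiag N (1 + \<rho>\<^sup>2) \<rho> \<rho> \<rho> * AR1_cov N \<rho>) $$ (i, j) =
      (1 + \<rho>\<^sup>2) * x (int i) - \<rho> * x (int i - 1) - \<rho> * x (int i + 1)"
    using ij by (subst sum[symmetric]) (simp add: scalar_prod_def lessThan_atLeast0 AR1_cov_def x_def)
  also have "\<dots> = (if i = j then 1 - \<rho>\<^sup>2 else 0)"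
  proof -
    consider "i = j" | "i < j" | "j < i" by linarith
    then show ?thesis
    proof cases
      case 1
      then show ?thesis by (simp add: x_def power2_eq_square algebra_simps)
    next
      case 2
      then have "x (int i) = \<rho> * x (int i + 1)" "x (int i - 1) = \<rho> * x (int i)"
        using step[of "int i"] step[of "int i - 1"] by (simp_all add: x_def)
      then show ?thesis using 2 by (simp add: power2_eq_square algebra_simps)
    next
      case 3
      then have "x (int i) = \<rho> * x (int i - 1)" "x (int i + 1) = \<rho> * x (int i)"
        using step'[of "int i"] step'[of "int i + 1"] by (simp_all add: x_def)
      then show ?thesis using 3 by (simp add: power2_eq_square algebra_simps)
    qed
  qed
  finally show "(tridiag N (1 + \<rho>\<^sup>2) \<rho> \<rho> \<rho> * AR1_cov N \<rho>) $$ (i, j) = ((1 - \<rho>\<^sup>2) \<cdot>\<^sub>m 1\<^sub>m N) $$ (i, j)"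
    using ij by simp
qed (auto simp: AR1_cov_def)

lemma AR1_cov_carrier [simp]: "AR1_cov N \<rho> \<in> carrier_mat N N"
  "dim_row (AR1_cov N \<rho>) = N" "dim_col (AR1_cov N \<rho>) = N"
  by (simp_all add: AR1_cov_def)

lemma transpose_AR1_cov [simp]: "transpose_mat (AR1_cov N \<rho>) = AR1_cov N \<rho>"
  by (rule eq_matI) (auto simp: AR1_cov_def abs_minus_commute)

text \<open>\<open>mat_inverse\<close> returns an option: exhibiting the inverse \<open>S\<close>
  rules out \<open>None\<close>, and uniqueness of inverses identifies the result.\<close>

lemma T_mat_eq:
  assumes "0 < \<rho>" "\<rho> < 1"
  shows "T_mat N \<rho> = tridiag N (1 + \<rho>\<^sup>2) \<rho> \<rho> \<rho>"
proof -
  let ?T = "tridiag N (1 + \<rho>\<^sup>2) \<rho> \<rho> \<rho>" and ?R = "AR1_cov N \<rho>"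
  have nz: "1 - \<rho>\<^sup>2 \<noteq> 0" using assms by (simp add: power2_eq_1_iff)
  define S where "S = (1 / (1 - \<rho>\<^sup>2)) \<cdot>\<^sub>m ?T"
  have S: "S \<in> carrier_mat N N" by (simp add: S_def)
  have SR: "S * ?R = 1\<^sub>m N"
    unfolding S_def using nz AR1_precision[of N \<rho>] mult_smult_assoc_mat[of ?T N N ?R N "1 / (1 - \<rho>\<^sup>2)"]
    by (auto intro: eq_matI)
  have RS: "?R * S = 1\<^sub>m N" by (rule mat_mult_left_right_inverse[OF S _ SR]) simp
  have "?R \<in> Units (ring_mat TYPE(real) N ())"
    unfolding Units_def using S SR RS by (auto simp: ring_mat_def intro!: bexI[of _ S])
  then obtain B where B: "mat_inverse ?R = Some B"
    using mat_inverse(1)[of ?R N] by fastforce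
  have inv: "B * ?R = 1\<^sub>m N" "B \<in> carrier_mat N N" using mat_inverse(2)[OF _ B, of N] by auto
  have "B = B * (?R * S)" using RS inv(2) by simp
  also have "\<dots> = (B * ?R) * S" by (rule assoc_mult_mat[symmetric, OF inv(2) _ S]) simp
  also have "\<dots> = S" using inv(1) S by simp
  finally have "B = S" .
  then have "T_mat N \<rho> = (1 - \<rho>\<^sup>2) \<cdot>\<^sub>m S" by (simp add: T_mat_def B)
  then show ?thesis using nz by (auto simp: S_def intro: eq_matI)
qed

section \<open>Trigonometric sums and orthogonality of the two DCTs\<close>

text \<open>Telescoping: each term times \<open>2 * sin a\<close> is a difference of consecutive
  values of \<open>sin (2 * k * a)\<close>.\<close>

lemma cos_double_sum: "(\<Sum>k<M. cos ((2 * real k + 1) * a)) * (2 * sin a) = sin (2 * real M * a)"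
proof (induction M)
  case (Suc M)
  have "cos ((2 * real M + 1) * a) * (2 * sin a) = sin (2 * real (Suc M) * a) - sin (2 * real M * a)"
    by (simp add: sin_diff_sin algebra_simps add_divide_distrib)
  with Suc show ?case by (simp add: distrib_right)
qed simp

text \<open>The angle \<open>a = p * pi / (2 * M)\<close> lies strictly between 0 and
  \<open>pi\<close>, so \<open>sin a\<close> can be cancelled, while \<open>2 * M * a\<close> is a
  multiple of \<open>pi\<close>.\<close>

lemma cos_sum_zero:
  assumes "0 < p" "p < 2 * real M" "p \<in> \<int>"
  shows "(\<Sum>k<M. cos ((2 * real k + 1) * (p * pi / (2 * real M)))) = 0"
proof -
  have M: "real M > 0" using assms by simp
  have "0 < p * pi / (2 * real M)" "p * pi / (2 * real M) < pi"
    using assms M by (simp_all add: divide_simps)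
  then have "sin (p * pi / (2 * real M)) > 0" by (rule sin_gt_zero)
  moreover have "sin (2 * real M * (p * pi / (2 * real M))) = 0"
    using M assms(3) by (auto simp: Ints_def sin_zero_iff_int2)
  ultimately show ?thesis using cos_double_sum[of "p * pi / (2 * real M)" M] by simp
qed

lemma cos_sum_diff_zero:
  assumes "n \<noteq> m" "n < M" "m < M"
  shows "(\<Sum>k<M. cos ((2 * real k + 1) * ((real n - real m) * pi / (2 * real M)))) = 0"
proof (cases "m < n")
  case True
  then show ?thesis using assms by (intro cos_sum_zero) auto
next
  case False
  have "(\<Sum>k<M. cos ((2 * real k + 1) * ((real m - real n) * pi / (2 * real M)))) = 0"
    using assms False by (intro cos_sum_zero) auto
  moreover have "(real m - real n) * pi / (2 * real M) = - ((real n - real m) * pi / (2 * real M))"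
    by (simp add: left_diff_distrib diff_divide_distrib)
  ultimately show ?thesis by (simp only: mult_minus_right cos_minus)
qed

text \<open>Product-to-sum splits an entry into cosine sums at the frequencies \<open>n - m\<close>
  and \<open>n + m\<close>, which vanish unless the frequency is 0. For \<open>n = m = 0\<close>
  both contribute, and the factor \<open>1 / sqrt 2\<close> of the first row compensates for
  that.\<close>

lemma DCT_II_orthogonal: "DCT_II M * transpose_mat (DCT_II M) = 1\<^sub>m M"
proof (rule eq_matI)
  fix n m assume "n < dim_row (1\<^sub>m M)" "m < dim_col (1\<^sub>m M)"
  then have nm: "n < M" "m < M" by auto
  define \<beta> :: "nat \<Rightarrow> real" where "\<beta> n = (if n = 0 then 1 / sqrt 2 else 1)" for n
  define S where "S p = (\<Sum>k<M. cos ((2 * real k + 1) * (p * pi / (2 * real M))))" for p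
  have "(DCT_II M * transpose_mat (DCT_II M)) $$ (n, m) =
    (\<Sum>k<M. sqrt (2 / real M) * \<beta> n * cos (pi * real n * (2 * real k + 1) / (2 * real M)) *
       (sqrt (2 / real M) * \<beta> m * cos (pi * real m * (2 * real k + 1) / (2 * real M))))"
    using nm by (simp add: scalar_prod_def lessThan_atLeast0 DCT_II_def \<beta>_def)
  also have "\<dots> = (\<Sum>k<M. \<beta> n * \<beta> m / real M * (cos ((2 * real k + 1) * ((real n - real m) * pi / (2 * real M)))
      + cos ((2 * real k + 1) * ((real n + real m) * pi / (2 * real M)))))"
  proof (rule sum.cong)
    fix k
    define A B where "A = pi * real n * (2 * real k + 1) / (2 * real M)"
      and "B = pi * real m * (2 * real k + 1) / (2 * real M)"
    have args: "(2 * real k + 1) * ((real n - real m) * pi / (2 * real M)) = A - B"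
      "(2 * real k + 1) * ((real n + real m) * pi / (2 * real M)) = A + B"
      by (simp_all add: A_def B_def diff_divide_distrib add_divide_distrib algebra_simps)
    have "sqrt (2 / real M) * \<beta> n * cos A * (sqrt (2 / real M) * \<beta> m * cos B) =
      (sqrt (2 / real M) * sqrt (2 / real M)) * \<beta> n * \<beta> m * (cos A * cos B)"
      by (simp only: mult_ac)
    also have "\<dots> = \<beta> n * \<beta> m / real M * (cos (A - B) + cos (A + B))"
      by (simp add: cos_times_cos)
    finally show "sqrt (2 / real M) * \<beta> n * cos (pi * real n * (2 * real k + 1) / (2 * real M)) *
       (sqrt (2 / real M) * \<beta> m * cos (pi * real m * (2 * real k + 1) / (2 * real M))) =
       \<beta> n * \<beta> m / real M * (cos ((2 * real k + 1) * ((real n - real m) * pi / (2 * real M)))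
      + cos ((2 * real k + 1) * ((real n + real m) * pi / (2 * real M))))"
      unfolding args by (simp only: A_def B_def)
  qed simp
  also have "\<dots> = \<beta> n * \<beta> m / real M * (S (real n - real m) + S (real n + real m))"
    by (simp only: S_def sum_distrib_left[symmetric] sum.distrib)
  also have "\<dots> = (if n = m then 1 else 0)"
  proof (cases "n = m")
    case True
    have "S (real n + real n) = (if n = 0 then real M else 0)"
    proof (cases "n = 0")
      case False
      then show ?thesis unfolding S_def using nm by (subst cos_sum_zero) auto
    qed (simp add: S_def)
    moreover have "S 0 = real M" by (simp add: S_def)
    ultimately show ?thesis using True nm by (simp add: \<beta>_def)
  next
    case False
    have "S (real n - real m) = 0"
      unfolding S_def by (rule cos_sum_diff_zero) (use False nm in auto)
    moreover have "S (real n + real m) = 0"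
      unfolding S_def by (rule cos_sum_zero) (use False nm in auto)
    ultimately show ?thesis using False by simp
  qed
  finally show "(DCT_II M * transpose_mat (DCT_II M)) $$ (n, m) = 1\<^sub>m M $$ (n, m)"
    using nm by simp
qed (auto simp: DCT_II_def)

text \<open>Here the second frequency is \<open>n + m + 1\<close>, strictly between 0 and
  \<open>2 * M\<close> for all rows, so no row needs a special normalisation.\<close>

lemma DCT_IV_orthogonal: "DCT_IV M * transpose_mat (DCT_IV M) = 1\<^sub>m M"
proof (rule eq_matI)
  fix n m assume "n < dim_row (1\<^sub>m M)" "m < dim_col (1\<^sub>m M)"
  then have nm: "n < M" "m < M" by auto
  define S where "S p = (\<Sum>k<M. cos ((2 * real k + 1) * (p * pi / (2 * real M))))" for p
  have "(DCT_IV M * transpose_mat (DCT_IV M)) $$ (n, m) =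
    (\<Sum>k<M. sqrt (2 / real M) * cos (pi * (2 * real n + 1) * (2 * real k + 1) / (4 * real M)) *
       (sqrt (2 / real M) * cos (pi * (2 * real m + 1) * (2 * real k + 1) / (4 * real M))))"
    using nm by (simp add: scalar_prod_def lessThan_atLeast0 DCT_IV_def)
  also have "\<dots> = (\<Sum>k<M. 1 / real M * (cos ((2 * real k + 1) * ((real n - real m) * pi / (2 * real M)))
      + cos ((2 * real k + 1) * ((real n + real m + 1) * pi / (2 * real M)))))"
  proof (rule sum.cong)
    fix k
    define A B where "A = pi * (2 * real n + 1) * (2 * real k + 1) / (4 * real M)"
      and "B = pi * (2 * real m + 1) * (2 * real k + 1) / (4 * real M)"
    have args: "(2 * real k + 1) * ((real n - real m) * pi / (2 * real M)) = A - B"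
      "(2 * real k + 1) * ((real n + real m + 1) * pi / (2 * real M)) = A + B"
      using nm by (simp_all add: A_def B_def field_simps)
    have "sqrt (2 / real M) * cos A * (sqrt (2 / real M) * cos B) =
      (sqrt (2 / real M) * sqrt (2 / real M)) * (cos A * cos B)"
      by (simp only: mult_ac)
    also have "\<dots> = 1 / real M * (cos (A - B) + cos (A + B))"
      using nm by (simp add: cos_times_cos field_simps)
    finally show "sqrt (2 / real M) * cos (pi * (2 * real n + 1) * (2 * real k + 1) / (4 * real M)) *
       (sqrt (2 / real M) * cos (pi * (2 * real m + 1) * (2 * real k + 1) / (4 * real M))) =
       1 / real M * (cos ((2 * real k + 1) * ((real n - real m) * pi / (2 * real M)))
      + cos ((2 * real k + 1) * ((real n + real m + 1) * pi / (2 * real M))))"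
      unfolding args by (simp only: A_def B_def)
  qed simp
  also have "\<dots> = 1 / real M * (S (real n - real m) + S (real n + real m + 1))"
    by (simp only: S_def sum_distrib_left[symmetric] sum.distrib)
  also have "\<dots> = (if n = m then 1 else 0)"
  proof -
    have "S (real n + real m + 1) = 0"
      unfolding S_def using nm by (intro cos_sum_zero) auto
    moreover have "S (real n - real m) = (if n = m then real M else 0)"
    proof (cases "n = m")
      case False
      then show ?thesis unfolding S_def using nm by (subst cos_sum_diff_zero) auto
    qed (simp add: S_def)
    ultimately show ?thesis using nm by simp
  qed
  finally show "(DCT_IV M * transpose_mat (DCT_IV M)) $$ (n, m) = 1\<^sub>m M $$ (n, m)"
    using nm by simp
qed (auto simp: DCT_IV_def)

section \<open>The spectrum of one branch\<close>

lemma outer_prod_mult: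
  assumes "C \<in> carrier_mat n m" "v \<in> carrier_vec m"
  shows "C * outer_prod v v * transpose_mat C = outer_prod (C *\<^sub>v v) (C *\<^sub>v v)"
proof -
  have c: "outer_prod v v \<in> carrier_mat m m" using assms by (simp add: outer_prod_def)
  have "(C * outer_prod v v) $$ (i, k) = (C *\<^sub>v v) $ i * v $ k" if "i < n" "k < m" for i k
    using assms that c by (simp add: outer_prod_def scalar_prod_def sum_distrib_left mult_ac)
  then have "C * outer_prod v v = mat n m (\<lambda>(i, k). (C *\<^sub>v v) $ i * v $ k)"
    using assms c by (intro eq_matI) auto
  also have "\<dots> * transpose_mat C = outer_prod (C *\<^sub>v v) (C *\<^sub>v v)"
  proof (rule eq_matI)
    fix i j
    assume "i < dim_row (outer_prod (C *\<^sub>v v) (C *\<^sub>v v))" "j < dim_col (outer_prod (C *\<^sub>v v) (C *\<^sub>v v))"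
    then have ij: "i < n" "j < n" using assms by (auto simp: outer_prod_def)
    have "(C *\<^sub>v v) $ j = (\<Sum>k<m. C $$ (j, k) * v $ k)"
      using ij assms by (simp add: scalar_prod_def lessThan_atLeast0)
    then have "(C *\<^sub>v v) $ i * (C *\<^sub>v v) $ j = (\<Sum>k<m. (C *\<^sub>v v) $ i * v $ k * C $$ (j, k))"
      by (simp only: sum_distrib_left mult_ac)
    then show "(mat n m (\<lambda>(i, k). (C *\<^sub>v v) $ i * v $ k) * transpose_mat C) $$ (i, j) =
        outer_prod (C *\<^sub>v v) (C *\<^sub>v v) $$ (i, j)"
      using ij assms
      by (simp add: outer_prod_def scalar_prod_def lessThan_atLeast0 del: index_mult_mat_vec)
  qed (use assms in \<open>auto simp: outer_prod_def\<close>)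
  finally show ?thesis .
qed

lemma orthogonal_row_sum:
  assumes "(Q :: real mat) \<in> carrier_mat n n" "Q * transpose_mat Q = 1\<^sub>m n" "i < n"
  shows "(\<Sum>k<n. (Q $$ (i, k))\<^sup>2) = 1"
  using arg_cong[OF assms(2), of "\<lambda>X. X $$ (i, i)"] assms(1,3)
  by (simp add: scalar_prod_def lessThan_atLeast0 power2_eq_square)

lemma orthogonal_entry_le_1:
  assumes "(Q :: real mat) \<in> carrier_mat n n" "Q * transpose_mat Q = 1\<^sub>m n" "i < n" "k < n"
  shows "\<bar>Q $$ (i, k)\<bar> \<le> 1"
proof -
  have "(Q $$ (i, k))\<^sup>2 \<le> (\<Sum>k<n. (Q $$ (i, k))\<^sup>2)"
    using assms(4) by (intro member_le_sum) auto
  then show ?thesis using orthogonal_row_sum[OF assms(1-3)] by (simp add: abs_square_le_1)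
qed

text \<open>Common abstraction of the even (\<open>\<epsilon> = 1\<close>) and odd
  (\<open>\<epsilon> = -1\<close>) half-size problems; \<open>\<epsilon>\<close> is the weight of
  the mirror condition at the inner end. The \<open>\<omega> n\<close> are the frequencies of the
  rows of \<open>C\<close>. A cell in \<open>mode\<close> covers only the lower half of the spacing
  \<open>pi / M\<close>; the upper half is left to the other branch. The range of
  \<open>\<omega> 0\<close> admits both 0 and \<open>pi / (2 * M)\<close>.\<close>

locale branch =
  fixes M :: nat and C :: "real mat" and \<omega> :: "nat \<Rightarrow> real" and \<epsilon> :: real
  assumes M_pos: "0 < M"
    and C: "C \<in> carrier_mat M M"
    and C_orth: "C * transpose_mat C = 1\<^sub>m M"
    and C_tridiag: "C * tridiag M 2 1 1 \<epsilon> = mat_diag M (\<lambda>n. 2 - 2 * cos (\<omega> n)) * C"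
    and \<omega>: "\<And>n. \<omega> n = \<omega> 0 + real n * pi / real M" "0 \<le> \<omega> 0" "\<omega> 0 \<le> pi / (2 * real M)"
    and mode: "\<And>\<rho> i. \<lbrakk>0 < \<rho>; \<rho> < 1; i < M\<rbrakk> \<Longrightarrow>
      \<exists>\<theta> x. \<omega> i < \<theta> \<and> \<theta> < \<omega> i + pi / (2 * real M) \<and>
        x (- 1) = \<rho> * x 0 \<and> x (int M) = \<epsilon> * x (int M - 1) \<and>
        (\<forall>k. x (k - 1) + x (k + 1) = 2 * cos \<theta> * x k) \<and> (\<exists>k<M. x (int k) \<noteq> 0)"
begin

definition \<Lambda> where "\<Lambda> = mat_diag M (\<lambda>n. 2 - 2 * cos (\<omega> n))"
definition T where "T \<rho> = \<rho> \<cdot>\<^sub>m (transpose_mat C * \<Lambda> * C) + (1 - \<rho>)\<^sup>2 \<cdot>\<^sub>m 1\<^sub>m M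
  + rank_one_term \<rho> (unit_vec M 0)"
definition G where "G \<rho> = C * T \<rho> * transpose_mat C"
definition D where "D \<rho> = \<rho> \<cdot>\<^sub>m \<Lambda> + (1 - \<rho>)\<^sup>2 \<cdot>\<^sub>m 1\<^sub>m M"
definition q where "q = C *\<^sub>v unit_vec M 0"

lemma \<Lambda>_carrier: "\<Lambda> \<in> carrier_mat M M" by (simp add: \<Lambda>_def)

lemma Ct_C: "transpose_mat C * C = 1\<^sub>m M" by (rule orthogonal_transpose[OF C C_orth])

lemma Ct: "transpose_mat C \<in> carrier_mat M M" using C by simp

lemma L_eq: "transpose_mat C * \<Lambda> * C = tridiag M 2 1 1 \<epsilon>"
proof -
  have "transpose_mat C * \<Lambda> * C = transpose_mat C * (C * tridiag M 2 1 1 \<epsilon>)"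
    unfolding C_tridiag \<Lambda>_def[symmetric] by (rule assoc_mult_mat[OF Ct \<Lambda>_carrier C])
  also have "\<dots> = (transpose_mat C * C) * tridiag M 2 1 1 \<epsilon>"
    by (rule assoc_mult_mat[symmetric, OF Ct C tridiag_carrier(1)])
  finally show ?thesis by (simp add: Ct_C)
qed

text \<open>Since \<open>2 * \<rho> + (1 - \<rho>)\<^sup>2 = 1 + \<rho>\<^sup>2\<close>, the effect
  of the rank-one term is to change the outer corner weight from 1 to \<open>\<rho>\<close>; the
  inner weight stays \<open>\<epsilon>\<close>.\<close>

lemma T_eq: "T \<rho> = tridiag M (1 + \<rho>\<^sup>2) \<rho> \<rho> \<epsilon>"
  unfolding T_def L_eq
  by (intro eq_matI)
    (auto simp: tridiag_def rank_one_term_def outer_prod_def power2_eq_square algebra_simps)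

lemma T_carrier: "T \<rho> \<in> carrier_mat M M" by (simp add: T_eq)

lemma G_carrier: "G \<rho> \<in> carrier_mat M M" using C T_carrier Ct by (auto simp: G_def)

lemma G_symmetric: "transpose_mat (G \<rho>) = G \<rho>"
proof -
  have CT: "C * T \<rho> \<in> carrier_mat M M" using C T_carrier by simp
  show ?thesis
    unfolding G_def transpose_mult[OF CT Ct] transpose_mult[OF C T_carrier]
    using assoc_mult_mat[OF C T_carrier Ct] by (simp add: T_eq)
qed

lemma q_carrier: "q \<in> carrier_vec M" using C by (simp add: q_def)

lemma q_index: "k < M \<Longrightarrow> q $ k = C $$ (k, 0)"
  using C M_pos by (simp add: q_def)

lemma G_eq: "G \<rho> = D \<rho> + rank_one_term \<rho> q"
proof -
  let ?L = "tridiag M 2 1 1 \<epsilon>" and ?R = "outer_prod (unit_vec M 0) (unit_vec M 0) :: real mat"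
  have R: "?R \<in> carrier_mat M M" by (simp add: outer_prod_def)
  have L: "?L \<in> carrier_mat M M" by simp
  have conj: "C * (A + B) * transpose_mat C = C * A * transpose_mat C + C * B * transpose_mat C"
    if "A \<in> carrier_mat M M" "B \<in> carrier_mat M M" for A B
    using that C Ct by (simp add: mult_add_distrib_mat[of C M M] add_mult_distrib_mat[of _ M M _ _ M])
  have conj_smult: "C * (a \<cdot>\<^sub>m A) * transpose_mat C = a \<cdot>\<^sub>m (C * A * transpose_mat C)"
    if "A \<in> carrier_mat M M" for a A
  proof -
    have "C * A \<in> carrier_mat M M" using C that by simp
    then show ?thesis
      using that C Ct by (simp add: mult_smult_distrib[OF C that] mult_smult_assoc_mat[of _ M M _ M])
  qed
  have "C * ?L * transpose_mat C = \<Lambda> * (C * transpose_mat C)"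
    unfolding C_tridiag \<Lambda>_def[symmetric] by (rule assoc_mult_mat[OF \<Lambda>_carrier C Ct])
  then have 1: "C * ?L * transpose_mat C = \<Lambda>" using \<Lambda>_carrier by (simp add: C_orth)
  have 2: "C * 1\<^sub>m M * transpose_mat C = 1\<^sub>m M" using C by (simp add: C_orth)
  have 3: "C * ?R * transpose_mat C = outer_prod q q"
    unfolding q_def using C by (intro outer_prod_mult) auto
  have "G \<rho> = \<rho> \<cdot>\<^sub>m (C * ?L * transpose_mat C) + (1 - \<rho>)\<^sup>2 \<cdot>\<^sub>m (C * 1\<^sub>m M * transpose_mat C)
      + (\<rho> * (1 - \<rho>)) \<cdot>\<^sub>m (C * ?R * transpose_mat C)"
    unfolding G_def T_def L_eq rank_one_term_def
    using R L by (simp only: conj conj_smult smult_carrier_mat add_carrier_mat one_carrier_mat)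
  then show ?thesis unfolding 1 2 3 D_def rank_one_term_def .
qed

lemma \<omega>_step: "i < j \<Longrightarrow> \<omega> i + pi / real M \<le> \<omega> j"
proof -
  assume "i < j"
  then have "real i + 1 \<le> real j" by simp
  then have "(real i + 1) * (pi / real M) \<le> real j * (pi / real M)"
    by (intro mult_right_mono) auto
  then show ?thesis unfolding \<omega>(1)[of i] \<omega>(1)[of j] distrib_right by simp
qed

lemma half_step: "pi / (2 * real M) < pi / real M" "0 < pi / (2 * real M)"
  using M_pos by (simp_all add: field_simps)

text \<open>Keeps all cells inside the interval from 0 to \<open>pi\<close>, where the cosine is
  strictly decreasing. The upper bound on \<open>\<omega> 0\<close> is what keeps the last cell from
  passing \<open>pi\<close>.\<close>

lemma \<omega>_bounds: "i < M \<Longrightarrow> 0 \<le> \<omega> i" "i < M \<Longrightarrow> \<omega> i + pi / (2 * real M) \<le> pi"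
proof -
  show "0 \<le> \<omega> i" using \<omega>(2) by (simp add: \<omega>(1)[of i])
  assume "i < M"
  then have "real i + 1 \<le> real M" by simp
  then have "(real i + 1) * (pi / real M) \<le> real M * (pi / real M)"
    by (intro mult_right_mono) auto
  then have "real i * pi / real M + pi / real M \<le> pi" using M_pos unfolding distrib_right by simp
  moreover have "pi / (2 * real M) + pi / (2 * real M) = pi / real M" by (simp add: field_simps)
  ultimately show "\<omega> i + pi / (2 * real M) \<le> pi" using \<omega>(3) by (simp add: \<omega>(1)[of i])
qed

definition in_cells :: "(nat \<Rightarrow> real) \<Rightarrow> bool" where
  "in_cells \<theta> \<longleftrightarrow> (\<forall>i<M. \<omega> i < \<theta> i \<and> \<theta> i < \<omega> i + pi / (2 * real M))"

lemma in_cells_cos: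
  assumes "in_cells \<theta>" "i < j" "j < M"
  shows "cos (\<theta> j) < cos (\<theta> i)"
proof (rule cos_monotone_0_pi)
  have "i < M" using assms by simp
  then have c: "\<omega> i < \<theta> i" "\<theta> i < \<omega> i + pi / (2 * real M)"
    "\<omega> j < \<theta> j" "\<theta> j < \<omega> j + pi / (2 * real M)"
    using assms(1,3) by (auto simp: in_cells_def)
  show "0 \<le> \<theta> i" using c(1) \<omega>_bounds(1)[OF \<open>i < M\<close>] by linarith
  show "\<theta> j \<le> pi" using c(4) \<omega>_bounds(2)[OF assms(3)] by linarith
  show "\<theta> i < \<theta> j" using c \<omega>_step[OF assms(2)] half_step by linarith
qed

text \<open>\<open>C\<close> carries the modes of \<open>T \<rho>\<close> to eigenvectors of
  \<open>G \<rho>\<close>. Disjoint cells make the \<open>M\<close> eigenvalues distinct, so they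
  are the whole spectrum.\<close>

lemma reference_frame:
  assumes \<rho>: "0 < \<rho>" "\<rho> < 1"
  obtains \<theta> P where "in_cells \<theta>" "eigenframe M (G \<rho>) (\<lambda>i. 1 + \<rho>\<^sup>2 - 2 * \<rho> * cos (\<theta> i)) P"
proof -
  have "\<forall>i. \<exists>\<theta> x. i < M \<longrightarrow> \<omega> i < \<theta> \<and> \<theta> < \<omega> i + pi / (2 * real M) \<and>
        x (- 1) = \<rho> * x 0 \<and> x (int M) = \<epsilon> * x (int M - 1) \<and>
        (\<forall>k. x (k - 1) + x (k + 1) = 2 * cos \<theta> * x k) \<and> (\<exists>k<M. x (int k) \<noteq> 0)"
    using mode[OF \<rho>] by blast
  then obtain \<theta> x where m: "\<And>i. i < M \<Longrightarrow> \<omega> i < \<theta> i \<and> \<theta> i < \<omega> i + pi / (2 * real M) \<and>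
        x i (- 1) = \<rho> * x i 0 \<and> x i (int M) = \<epsilon> * x i (int M - 1) \<and>
        (\<forall>k. x i (k - 1) + x i (k + 1) = 2 * cos (\<theta> i) * x i k) \<and> (\<exists>k<M. x i (int k) \<noteq> 0)"
    by metis
  have cells: "in_cells \<theta>" using m by (simp add: in_cells_def)
  define v where "v i = vec M (\<lambda>k. x i (int k))" for i
  define \<mu> where "\<mu> i = 1 + \<rho>\<^sup>2 - 2 * \<rho> * cos (\<theta> i)" for i
  have v: "v i \<in> carrier_vec M" for i by (simp add: v_def)
  have Tv: "T \<rho> *\<^sub>v v i = \<mu> i \<cdot>\<^sub>v v i" if "i < M" for i
    unfolding T_eq v_def \<mu>_def using m[OF that] by (intro tridiag_eigenvector) auto
  have Cv: "C *\<^sub>v v i \<in> carrier_vec M" for i by (rule mult_mat_vec_carrier[OF C v])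
  have CtCv: "transpose_mat C *\<^sub>v (C *\<^sub>v v i) = v i" for i
    using assoc_mult_mat_vec[OF Ct C v[of i]] v[of i] by (simp add: Ct_C)
  have ev: "C *\<^sub>v v i \<in> carrier_vec M \<and> C *\<^sub>v v i \<noteq> 0\<^sub>v M \<and> G \<rho> *\<^sub>v (C *\<^sub>v v i) = \<mu> i \<cdot>\<^sub>v (C *\<^sub>v v i)"
    if i: "i < M" for i
  proof (intro conjI)
    show "C *\<^sub>v v i \<noteq> 0\<^sub>v M"
    proof
      assume "C *\<^sub>v v i = 0\<^sub>v M"
      moreover have "transpose_mat C *\<^sub>v 0\<^sub>v M = 0\<^sub>v M" using Ct by (intro eq_vecI) auto
      ultimately have "v i = 0\<^sub>v M" using CtCv[of i] by simp
      moreover obtain k where "k < M" "x i (int k) \<noteq> 0" using m[OF i] by blast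
      ultimately show False by (auto simp: v_def vec_eq_iff)
    qed
    have "G \<rho> *\<^sub>v (C *\<^sub>v v i) = (C * T \<rho>) *\<^sub>v (transpose_mat C *\<^sub>v (C *\<^sub>v v i))"
      unfolding G_def by (rule assoc_mult_mat_vec[OF mult_carrier_mat[OF C T_carrier] Ct Cv])
    also have "\<dots> = C *\<^sub>v (T \<rho> *\<^sub>v v i)"
      unfolding CtCv by (rule assoc_mult_mat_vec[OF C T_carrier v])
    also have "\<dots> = \<mu> i \<cdot>\<^sub>v (C *\<^sub>v v i)"
      unfolding Tv[OF i] by (rule mult_mat_vec[OF C v])
    finally show "G \<rho> *\<^sub>v (C *\<^sub>v v i) = \<mu> i \<cdot>\<^sub>v (C *\<^sub>v v i)" .
  qed (rule Cv)
  have distinct: "\<mu> i \<noteq> \<mu> j" if "i < j" "j < M" for i j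
    using in_cells_cos[OF cells that] \<rho> by (simp add: \<mu>_def)
  have "\<exists>P. eigenframe M (G \<rho>) \<mu> P"
    by (rule eigenframe_exists[OF G_carrier G_symmetric, where v = "\<lambda>i. C *\<^sub>v v i"])
      (simp_all add: ev distinct del: index_mult_mat_vec)
  then show ?thesis using that[OF cells] unfolding \<mu>_def by blast
qed

lemma increasing_exists:
  assumes \<rho>: "0 < \<rho>" "\<rho> < 1"
  shows "\<exists>Q. increasing_eigenvector_mat (G \<rho>) Q"
proof -
  obtain \<theta> P where P: "in_cells \<theta>" "eigenframe M (G \<rho>) (\<lambda>i. 1 + \<rho>\<^sup>2 - 2 * \<rho> * cos (\<theta> i)) P"
    by (rule reference_frame[OF \<rho>])
  have "1 + \<rho>\<^sup>2 - 2 * \<rho> * cos (\<theta> i) \<le> 1 + \<rho>\<^sup>2 - 2 * \<rho> * cos (\<theta> j)" if "i < j" "j < M" for i j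
    using in_cells_cos[OF P(1) that] \<rho> by simp
  then show ?thesis
    unfolding ordered_eigenvector_mat_iff[OF G_carrier G_symmetric] using P(2) by blast
qed

text \<open>Transfers the location in cells from the reference frame to an arbitrary admissible
  \<open>Q\<close>, whose eigenvalues agree with the reference ones index by index by
  uniqueness.\<close>

lemma increasing_frame:
  assumes \<rho>: "0 < \<rho>" "\<rho> < 1" and Q: "increasing_eigenvector_mat (G \<rho>) Q"
  obtains \<theta> where "in_cells \<theta>" "eigenframe M (G \<rho>) (\<lambda>i. 1 + \<rho>\<^sup>2 - 2 * \<rho> * cos (\<theta> i)) Q"
proof -
  obtain \<theta> P where P: "in_cells \<theta>" "eigenframe M (G \<rho>) (\<lambda>i. 1 + \<rho>\<^sup>2 - 2 * \<rho> * cos (\<theta> i)) P"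
    by (rule reference_frame[OF \<rho>])
  obtain \<nu> where \<nu>: "eigenframe M (G \<rho>) \<nu> Q" "\<And>i j. i < j \<Longrightarrow> j < M \<Longrightarrow> \<nu> i \<le> \<nu> j"
    using Q unfolding ordered_eigenvector_mat_iff[OF G_carrier G_symmetric] by blast
  have lt: "1 + \<rho>\<^sup>2 - 2 * \<rho> * cos (\<theta> i) < 1 + \<rho>\<^sup>2 - 2 * \<rho> * cos (\<theta> j)" if "i < j" "j < M" for i j
    using in_cells_cos[OF P(1) that] \<rho> by simp
  have "\<nu> i = 1 + \<rho>\<^sup>2 - 2 * \<rho> * cos (\<theta> i)" if "i < M" for i
  proof (rule eigenframe_unique(2)[OF P(2) \<nu>(1) _ _ that, where ord = "(\<le>)"])
    show "1 + \<rho>\<^sup>2 - 2 * \<rho> * cos (\<theta> i) \<noteq> 1 + \<rho>\<^sup>2 - 2 * \<rho> * cos (\<theta> j) \<and>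
        \<not> 1 + \<rho>\<^sup>2 - 2 * \<rho> * cos (\<theta> j) \<le> 1 + \<rho>\<^sup>2 - 2 * \<rho> * cos (\<theta> i)"
      if "i < j" "j < M" for i j
      using lt[OF that] by linarith
  qed (rule \<nu>(2))
  then have "mat_diag M \<nu> = mat_diag M (\<lambda>i. 1 + \<rho>\<^sup>2 - 2 * \<rho> * cos (\<theta> i))"
    by (auto simp: mat_diag_def)
  then show ?thesis using that[OF P(1)] \<nu>(1) by (simp add: eigenframe_def)
qed

lemma G_1: "G 1 = \<Lambda>"
  using \<Lambda>_carrier q_carrier
  by (auto simp: G_eq D_def rank_one_term_def outer_prod_def intro!: eq_matI)

lemma \<Lambda>_increasing: "i < j \<Longrightarrow> j < M \<Longrightarrow> 2 - 2 * cos (\<omega> i) < 2 - 2 * cos (\<omega> j)"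
proof -
  assume ij: "i < j" "j < M"
  have "cos (\<omega> j) < cos (\<omega> i)"
    by (rule cos_monotone_0_pi)
      (use ij \<omega>_bounds(1)[of i] \<omega>_bounds(2)[of j] \<omega>_step[OF ij(1)] half_step in linarith)+
  then show ?thesis by simp
qed

lemma sorted_\<Lambda>: "sorted_wrt (<) (diag_mat \<Lambda>)"
  using \<Lambda>_increasing by (auto simp: sorted_wrt_iff_nth_less diag_mat_def \<Lambda>_def mat_diag_def)

lemma diagonal_\<Lambda>: "diagonal_mat \<Lambda>"
  by (auto simp: diagonal_mat_def \<Lambda>_def mat_diag_def)

lemma eigenframe_\<Lambda>: "eigenframe M \<Lambda> (\<lambda>n. 2 - 2 * cos (\<omega> n)) (1\<^sub>m M)"
  using \<Lambda>_carrier by (simp add: eigenframe_def \<Lambda>_def)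

text \<open>\<open>reference_frame\<close> stops short of \<open>\<rho> = 1\<close>. There
  \<open>\<Lambda>\<close> is diagonal with strictly increasing entries, so the identity serves as
  reference frame; conversely, sign matrices are orthogonal and commute with
  \<open>\<Lambda>\<close>.\<close>

lemma increasing_G_1_iff: "increasing_eigenvector_mat (G 1) Q \<longleftrightarrow> row_sign_eq Q (1\<^sub>m M)"
proof
  assume "increasing_eigenvector_mat (G 1) Q"
  then obtain \<nu> where \<nu>: "eigenframe M \<Lambda> \<nu> Q" "\<And>i j. i < j \<Longrightarrow> j < M \<Longrightarrow> \<nu> i \<le> \<nu> j"
    unfolding ordered_eigenvector_mat_iff[OF G_carrier G_symmetric] unfolding G_1 by blast
  show "row_sign_eq Q (1\<^sub>m M)"
  proof (rule eigenframe_unique(1)[OF eigenframe_\<Lambda> \<nu>(1), where ord = "(\<le>)"])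
    show "2 - 2 * cos (\<omega> i) \<noteq> 2 - 2 * cos (\<omega> j) \<and> \<not> 2 - 2 * cos (\<omega> j) \<le> 2 - 2 * cos (\<omega> i)"
      if "i < j" "j < M" for i j
      using \<Lambda>_increasing[OF that] by linarith
  qed (rule \<nu>(2))
next
  assume "row_sign_eq Q (1\<^sub>m M)"
  then obtain \<sigma> where \<sigma>: "\<forall>i. \<sigma> i \<in> {1, -1 :: real}" "Q = mat_diag M \<sigma>"
    unfolding row_sign_eq_def using right_mult_one_mat[OF mat_diag_dim] by (metis index_one_mat(2))
  have "\<sigma> i * \<sigma> i = 1" for i using spec[OF \<sigma>(1), of i] by auto
  then have "eigenframe M \<Lambda> (\<lambda>n. 2 - 2 * cos (\<omega> n)) Q"
    using \<Lambda>_carrier by (simp add: eigenframe_def \<sigma>(2) \<Lambda>_def mult.commute)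
  then show "increasing_eigenvector_mat (G 1) Q"
    unfolding ordered_eigenvector_mat_iff[OF G_carrier G_symmetric] unfolding G_1
    using \<Lambda>_increasing less_imp_le by blast
qed

end

section \<open>The limit of one branch and the two DCT branches\<close>

lemma eventually_unit_interval: "\<forall>\<^sub>F \<rho> in at_left (1::real). 0 < \<rho> \<and> \<rho> < 1"
  by (rule eventually_at_leftI[of 0]) auto

lemma rank_one_term_tendsto:
  "v \<in> carrier_vec M \<Longrightarrow> mat_tendsto (\<lambda>\<rho>. rank_one_term \<rho> v) (0\<^sub>m M M) (at_left 1)"
  unfolding mat_tendsto_def rank_one_term_def outer_prod_def
  by (auto intro!: tendsto_eq_intros)

context branch
begin

lemma D_tendsto: "mat_tendsto D \<Lambda> (at_left 1)"
  using \<Lambda>_carrier unfolding mat_tendsto_def D_def by (auto intro!: tendsto_eq_intros)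

lemma D_1: "D 1 = \<Lambda>"
  using \<Lambda>_carrier by (auto simp: D_def intro!: eq_matI)

text \<open>A lower bound for \<open>\<bar>cos (\<omega> j) - cos (\<theta> i)\<bar>\<close> that is
  free of \<open>\<rho>\<close>: the cosine distance from \<open>\<omega> j\<close> to the nearer
  end of cell \<open>i\<close>, which is the left end for \<open>j < i\<close> and the right end for
  \<open>j > i\<close>.\<close>

definition gap :: "nat \<Rightarrow> nat \<Rightarrow> real" where
  "gap i j = (if j < i then cos (\<omega> j) - cos (\<omega> i)
    else cos (\<omega> i + pi / (2 * real M)) - cos (\<omega> j))"

lemma gap_pos:
  assumes "i \<noteq> j" "i < M" "j < M"
  shows "gap i j > 0"
proof (cases "j < i")
  case True
  then show ?thesis using \<Lambda>_increasing[of j i] assms by (simp add: gap_def)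
next
  case False
  then have "i < j" using assms by simp
  have "cos (\<omega> j) < cos (\<omega> i + pi / (2 * real M))"
    by (rule cos_monotone_0_pi)
      (use \<omega>_bounds(1)[OF assms(2)] \<omega>_bounds(2)[OF assms(3)] \<omega>_step[OF \<open>i < j\<close>] half_step in linarith)+
  then show ?thesis using False by (simp add: gap_def)
qed

lemma gap_le:
  assumes "in_cells \<theta>" "i \<noteq> j" "i < M" "j < M"
  shows "gap i j \<le> \<bar>cos (\<omega> j) - cos (\<theta> i)\<bar>"
proof -
  have b: "\<omega> i < \<theta> i" "\<theta> i < \<omega> i + pi / (2 * real M)" using assms by (auto simp: in_cells_def)
  have "cos (\<theta> i) \<le> cos (\<omega> i)"
    by (rule cos_monotone_0_pi_le) (use b \<omega>_bounds[OF assms(3)] in linarith)+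
  moreover have "cos (\<omega> i + pi / (2 * real M)) \<le> cos (\<theta> i)"
    by (rule cos_monotone_0_pi_le) (use b \<omega>_bounds[OF assms(3)] in linarith)+
  ultimately show ?thesis by (cases "j < i") (simp_all add: gap_def abs_if)
qed

text \<open>
  Column \<open>j\<close> of \<open>Q G(\<rho>) = diag(\<mu>) Q\<close> reads
  \<open>2 \<rho> (cos \<omega>\<^sub>j - cos \<theta>\<^sub>i) Q\<^sub>i\<^sub>j = \<rho> (1 - \<rho>) q\<^sub>j \<Sum>\<^sub>k Q\<^sub>i\<^sub>k q\<^sub>k\<close>, and the left factor
  stays away from \<open>0\<close> as \<open>\<rho> \<rightarrow> 1\<close>.
\<close>
lemma off_diagonal_bound:
  assumes \<rho>: "0 < \<rho>" "\<rho> < 1" and Q: "increasing_eigenvector_mat (G \<rho>) Q"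
    and ij: "i \<noteq> j" "i < M" "j < M"
  shows "\<bar>Q $$ (i, j)\<bar> \<le> (1 - \<rho>) * (real M / (2 * gap i j))"
proof -
  obtain \<theta> where \<theta>: "in_cells \<theta>" "eigenframe M (G \<rho>) (\<lambda>i. 1 + \<rho>\<^sup>2 - 2 * \<rho> * cos (\<theta> i)) Q"
    by (rule increasing_frame[OF \<rho> Q])
  then have Q': "Q \<in> carrier_mat M M" "Q * transpose_mat Q = 1\<^sub>m M"
    "Q * G \<rho> = mat_diag M (\<lambda>i. 1 + \<rho>\<^sup>2 - 2 * \<rho> * cos (\<theta> i)) * Q"
    by (auto simp: eigenframe_def)
  define s where "s = (\<Sum>k<M. Q $$ (i, k) * q $ k)"
  have G_entry: "G \<rho> $$ (k, j) = (if k = j then \<rho> * (2 - 2 * cos (\<omega> j)) + (1 - \<rho>)\<^sup>2 else 0)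
      + \<rho> * (1 - \<rho>) * (q $ k * q $ j)" if "k < M" for k
    using that ij q_carrier
    by (simp add: G_eq D_def \<Lambda>_def mat_diag_def rank_one_term_def outer_prod_def)
  have "(Q * G \<rho>) $$ (i, j) = (\<Sum>k<M. Q $$ (i, k) * G \<rho> $$ (k, j))"
    using Q'(1) G_carrier[of \<rho>] ij by (simp add: scalar_prod_def lessThan_atLeast0)
  also have "\<dots> = (\<Sum>k<M. (if k = j then Q $$ (i, j) * (\<rho> * (2 - 2 * cos (\<omega> j)) + (1 - \<rho>)\<^sup>2) else 0)
      + \<rho> * (1 - \<rho>) * q $ j * (Q $$ (i, k) * q $ k))"
    by (intro sum.cong) (auto simp: G_entry algebra_simps)
  also have "\<dots> = Q $$ (i, j) * (\<rho> * (2 - 2 * cos (\<omega> j)) + (1 - \<rho>)\<^sup>2) + \<rho> * (1 - \<rho>) * q $ j * s"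
    using ij by (simp add: sum.distrib sum_distrib_left[symmetric] s_def)
  finally have "(1 + \<rho>\<^sup>2 - 2 * \<rho> * cos (\<theta> i)) * Q $$ (i, j) =
      Q $$ (i, j) * (\<rho> * (2 - 2 * cos (\<omega> j)) + (1 - \<rho>)\<^sup>2) + \<rho> * (1 - \<rho>) * q $ j * s"
    using Q'(3) mult_mat_diag_index(1)[OF Q'(1) ij(2,3)] by simp
  \<comment> \<open>Since \<open>2 * \<rho> + (1 - \<rho>)\<^sup>2 = 1 + \<rho>\<^sup>2\<close>, the
    terms without a cosine cancel.\<close>
  then have "\<rho> * (2 * (cos (\<omega> j) - cos (\<theta> i)) * Q $$ (i, j)) = \<rho> * ((1 - \<rho>) * (q $ j * s))"
    by (simp add: power2_eq_square algebra_simps)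
  then have eq: "2 * (cos (\<omega> j) - cos (\<theta> i)) * Q $$ (i, j) = (1 - \<rho>) * (q $ j * s)"
    using \<rho> by simp
  have q1: "\<bar>q $ k\<bar> \<le> 1" if "k < M" for k
    using orthogonal_entry_le_1[OF C C_orth that M_pos] q_index[OF that] by simp
  have "\<bar>Q $$ (i, k) * q $ k\<bar> \<le> 1" if "k < M" for k
    using mult_mono[OF orthogonal_entry_le_1[OF Q'(1,2) ij(2) that] q1[OF that]] by (simp add: abs_mult)
  \<comment> \<open>A crude count of \<open>M\<close> products, each bounded by 1; this is the
    origin of \<open>M\<close> in the bound.\<close>
  then have "\<bar>s\<bar> \<le> (\<Sum>k<M. 1)"
    unfolding s_def by (intro order.trans[OF sum_abs] sum_mono) simp
  then have "\<bar>q $ j * s\<bar> \<le> 1 * real M"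
    unfolding abs_mult using q1[OF ij(3)] by (intro mult_mono) auto
  then have "\<bar>2 * (cos (\<omega> j) - cos (\<theta> i)) * Q $$ (i, j)\<bar> \<le> (1 - \<rho>) * real M"
    unfolding eq using \<rho> by (simp add: abs_mult)
  moreover have "2 * gap i j * \<bar>Q $$ (i, j)\<bar> \<le> 2 * \<bar>cos (\<omega> j) - cos (\<theta> i)\<bar> * \<bar>Q $$ (i, j)\<bar>"
    using gap_le[OF \<theta>(1) ij] by (intro mult_right_mono) auto
  moreover have "\<bar>2 * (cos (\<omega> j) - cos (\<theta> i)) * Q $$ (i, j)\<bar> =
      2 * \<bar>cos (\<omega> j) - cos (\<theta> i)\<bar> * \<bar>Q $$ (i, j)\<bar>"
    by (simp only: abs_mult abs_numeral)
  ultimately have "2 * gap i j * \<bar>Q $$ (i, j)\<bar> \<le> (1 - \<rho>) * real M" by linarith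
  then show ?thesis using gap_pos[OF ij] by (simp add: field_simps)
qed

text \<open>Once the off-diagonal entries vanish, the unit norm of a row forces the modulus of its
  diagonal entry to tend to 1. The sign \<open>\<sigma>\<close> makes that entry nonnegative and may
  jump with \<open>\<rho>\<close>.\<close>

lemma increasing_tendsto:
  assumes Q: "\<And>\<rho>. 0 < \<rho> \<Longrightarrow> \<rho> < 1 \<Longrightarrow> increasing_eigenvector_mat (G \<rho>) (Q \<rho>)"
  shows "mat_tendsto_upto_row_signs Q (1\<^sub>m M) (at_left 1)"
proof -
  define \<sigma> :: "real \<Rightarrow> nat \<Rightarrow> real" where "\<sigma> \<rho> i = (if Q \<rho> $$ (i, i) < 0 then -1 else 1)" for \<rho> i
  have Q_mat: "Q \<rho> \<in> carrier_mat M M" "Q \<rho> * transpose_mat (Q \<rho>) = 1\<^sub>m M" if "0 < \<rho>" "\<rho> < 1" for \<rho>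
    using Q[OF that] G_carrier[of \<rho>] by (auto simp: ordered_eigenvector_mat_def)
  have off: "((\<lambda>\<rho>. Q \<rho> $$ (i, j)) \<longlongrightarrow> 0) (at_left 1)" if ij: "i \<noteq> j" "i < M" "j < M" for i j
  proof (rule tendsto_rabs_zero_cancel, rule tendsto_sandwich[OF _ _ tendsto_const])
    show "\<forall>\<^sub>F \<rho> in at_left 1. 0 \<le> \<bar>Q \<rho> $$ (i, j)\<bar>" by simp
    show "\<forall>\<^sub>F \<rho> in at_left 1. \<bar>Q \<rho> $$ (i, j)\<bar> \<le> (1 - \<rho>) * (real M / (2 * gap i j))"
      using eventually_unit_interval
      by eventually_elim (use off_diagonal_bound Q ij in auto)
    show "((\<lambda>\<rho>. (1 - \<rho>) * (real M / (2 * gap i j))) \<longlongrightarrow> 0) (at_left 1)"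
      using gap_pos[OF ij] by (auto intro!: tendsto_eq_intros)
  qed
  have diag: "((\<lambda>\<rho>. \<bar>Q \<rho> $$ (i, i)\<bar>) \<longlongrightarrow> 1) (at_left 1)" if i: "i < M" for i
  proof -
    have "((\<lambda>\<rho>. sqrt (1 - (\<Sum>k\<in>{..<M} - {i}. (Q \<rho> $$ (i, k))\<^sup>2))) \<longlongrightarrow>
        sqrt (1 - (\<Sum>k\<in>{..<M} - {i}. 0\<^sup>2))) (at_left 1)"
      by (intro tendsto_intros off) (use i in auto)
    moreover have "\<forall>\<^sub>F \<rho> in at_left 1.
        sqrt (1 - (\<Sum>k\<in>{..<M} - {i}. (Q \<rho> $$ (i, k))\<^sup>2)) = \<bar>Q \<rho> $$ (i, i)\<bar>"
      using eventually_unit_interval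
    proof eventually_elim
      case (elim \<rho>)
      then have "(\<Sum>k<M. (Q \<rho> $$ (i, k))\<^sup>2) = 1"
        using orthogonal_row_sum[OF Q_mat i] by simp
      then have "1 - (\<Sum>k\<in>{..<M} - {i}. (Q \<rho> $$ (i, k))\<^sup>2) = (Q \<rho> $$ (i, i))\<^sup>2"
        using i by (subst (asm) sum.remove[of _ i]) auto
      then show ?case by simp
    qed
    ultimately show ?thesis using tendsto_cong by force
  qed
  have entry: "((\<lambda>\<rho>. \<sigma> \<rho> i * Q \<rho> $$ (i, j)) \<longlongrightarrow> 1\<^sub>m M $$ (i, j)) (at_left 1)" if "i < M" "j < M" for i j
  proof (cases "i = j")
    case True
    have "\<sigma> \<rho> i * Q \<rho> $$ (i, i) = \<bar>Q \<rho> $$ (i, i)\<bar>" for \<rho> by (simp add: \<sigma>_def)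
    then show ?thesis using diag that True by simp
  next
    case False
    have eq: "\<bar>\<sigma> \<rho> i * Q \<rho> $$ (i, j)\<bar> = \<bar>Q \<rho> $$ (i, j)\<bar>" for \<rho> by (simp add: \<sigma>_def)
    have "((\<lambda>\<rho>. \<bar>\<sigma> \<rho> i * Q \<rho> $$ (i, j)\<bar>) \<longlongrightarrow> 0) (at_left 1)"
      unfolding eq by (rule tendsto_rabs_zero[OF off[OF False that]])
    then show ?thesis using that False by (simp add: tendsto_rabs_zero_cancel)
  qed
  have "mat_tendsto (\<lambda>\<rho>. mat_diag M (\<sigma> \<rho>) * Q \<rho>) (1\<^sub>m M) (at_left 1)"
    unfolding mat_tendsto_def
  proof (intro conjI allI impI)
    show "\<forall>\<^sub>F \<rho> in at_left 1. mat_diag M (\<sigma> \<rho>) * Q \<rho> \<in> carrier_mat (dim_row (1\<^sub>m M)) (dim_col (1\<^sub>m M))"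
      using eventually_unit_interval by eventually_elim (auto intro!: mult_carrier_mat[OF mat_diag_dim] Q_mat(1))
    fix i j assume "i < dim_row (1\<^sub>m M)" "j < dim_col (1\<^sub>m M)"
    then have ij: "i < M" "j < M" by auto
    have "\<forall>\<^sub>F \<rho> in at_left 1. \<sigma> \<rho> i * Q \<rho> $$ (i, j) = (mat_diag M (\<sigma> \<rho>) * Q \<rho>) $$ (i, j)"
      using eventually_unit_interval
      by eventually_elim (simp add: mult_mat_diag_index(1)[OF Q_mat(1) ij])
    then show "((\<lambda>\<rho>. (mat_diag M (\<sigma> \<rho>) * Q \<rho>) $$ (i, j)) \<longlongrightarrow> 1\<^sub>m M $$ (i, j)) (at_left 1)"
      using entry[OF ij] by (rule Lim_transform_eventually[rotated])
  qed
  moreover have "\<sigma> \<rho> i \<in> {1, -1}" for \<rho> i by (simp add: \<sigma>_def)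
  ultimately show ?thesis unfolding mat_tendsto_upto_row_signs_def by auto
qed

end

section \<open>DCT rows as cosine sequences, and the modes of both branches\<close>

text \<open>The phase is odd about \<open>k = -1/2\<close>, which gives the outer condition with
  weight 1. At the inner end the phases are \<open>2 * M * a \<plusminus> a\<close>, so the mirror
  sign is \<open>1\<close> when \<open>2 * M * a\<close> is a multiple of \<open>pi\<close> (DCT-II)
  and \<open>-1\<close> when it is an odd multiple of \<open>pi / 2\<close> (DCT-IV).\<close>

lemma cos_sequence:
  fixes s a :: real
  defines "x \<equiv> \<lambda>k::int. s * cos (a * (2 * of_int k + 1))"
  shows "x (k - 1) + x (k + 1) = 2 * cos (2 * a) * x k" "x (- 1) = x 0"
    "x (int M) = s * cos (2 * real M * a + a)" "x (int M - 1) = s * cos (2 * real M * a - a)"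
proof -
  have "cos (a * (2 * of_int k + 1) - 2 * a) + cos (a * (2 * of_int k + 1) + 2 * a) =
      2 * cos (2 * a) * cos (a * (2 * of_int k + 1))"
    by (simp add: cos_diff cos_add)
  then have "s * cos (a * (2 * of_int k + 1) - 2 * a) + s * cos (a * (2 * of_int k + 1) + 2 * a) =
      2 * cos (2 * a) * (s * cos (a * (2 * of_int k + 1)))"
    by (simp add: distrib_left[symmetric] mult.left_commute)
  then show "x (k - 1) + x (k + 1) = 2 * cos (2 * a) * x k"
    by (simp add: x_def algebra_simps)
  show "x (- 1) = x 0" by (simp add: x_def)
  show "x (int M) = s * cos (2 * real M * a + a)" "x (int M - 1) = s * cos (2 * real M * a - a)"
    by (simp_all add: x_def algebra_simps)
qed

lemma DCT_II_tridiag: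
  "DCT_II M * tridiag M 2 1 1 1 = mat_diag M (\<lambda>n. 2 - 2 * cos (real n * pi / real M)) * DCT_II M"
proof (subst eigenrows_iff)
  show "\<forall>n<M. tridiag M 2 1 1 1 *\<^sub>v row (DCT_II M) n =
      (2 - 2 * cos (real n * pi / real M)) \<cdot>\<^sub>v row (DCT_II M) n"
  proof (intro allI impI)
    fix n assume n: "n < M"
    define a where "a = pi * real n / (2 * real M)"
    define s where "s = sqrt (2 / real M) * (if n = 0 then 1 / sqrt 2 else 1)"
    define x where "x k = s * cos (a * (2 * of_int k + 1))" for k :: int
    note seq = cos_sequence[of s a, folded x_def]
    have row: "row (DCT_II M) n = vec M (\<lambda>k. x (int k))"
      using n by (intro eq_vecI) (auto simp: DCT_II_def x_def a_def s_def)
    have Ma: "2 * real M * a = real n * pi" using n by (simp add: a_def)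
    have "x (int M) = x (int M - 1)" unfolding seq(3,4) Ma by (simp add: cos_add cos_diff)
    moreover have "2 * a = real n * pi / real M" by (simp add: a_def)
    ultimately show "tridiag M 2 1 1 1 *\<^sub>v row (DCT_II M) n =
        (2 - 2 * cos (real n * pi / real M)) \<cdot>\<^sub>v row (DCT_II M) n"
      unfolding row using tridiag_eigenvector[of x 1 M 1 "cos (2 * a)" 2 1] seq(1,2) by simp
  qed
qed (auto simp: DCT_II_def)

lemma DCT_IV_tridiag:
  "DCT_IV M * tridiag M 2 1 1 (-1) =
    mat_diag M (\<lambda>n. 2 - 2 * cos ((2 * real n + 1) * pi / (2 * real M))) * DCT_IV M"
proof (subst eigenrows_iff)
  show "\<forall>n<M. tridiag M 2 1 1 (-1) *\<^sub>v row (DCT_IV M) n =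
      (2 - 2 * cos ((2 * real n + 1) * pi / (2 * real M))) \<cdot>\<^sub>v row (DCT_IV M) n"
  proof (intro allI impI)
    fix n assume n: "n < M"
    define a where "a = pi * (2 * real n + 1) / (4 * real M)"
    define s where "s = sqrt (2 / real M)"
    define x where "x k = s * cos (a * (2 * of_int k + 1))" for k :: int
    note seq = cos_sequence[of s a, folded x_def]
    have row: "row (DCT_IV M) n = vec M (\<lambda>k. x (int k))"
      using n by (intro eq_vecI) (auto simp: DCT_IV_def x_def a_def s_def)
    have Ma: "2 * real M * a = real n * pi + pi / 2" using n by (simp add: a_def field_simps)
    have "x (int M) = (-1) * x (int M - 1)" unfolding seq(3,4) Ma by (simp add: cos_add cos_diff sin_add)
    moreover have "2 * a = (2 * real n + 1) * pi / (2 * real M)" by (simp add: a_def)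
    ultimately show "tridiag M 2 1 1 (-1) *\<^sub>v row (DCT_IV M) n =
        (2 - 2 * cos ((2 * real n + 1) * pi / (2 * real M))) \<cdot>\<^sub>v row (DCT_IV M) n"
      unfolding row using tridiag_eigenvector[of x 1 M "-1" "cos (2 * a)" 2 1] seq(1,2) by simp
  qed
qed (auto simp: DCT_IV_def)

text \<open>The factor \<open>s\<close> will be \<open>(-1) ^ i\<close>, so one form covers both
  directions of the sign change; strict signs at the ends keep the root in the open cell.\<close>

lemma root_between:
  fixes f :: "real \<Rightarrow> real"
  assumes "a < b" "continuous_on {a..b} f" "0 < s * f a" "s * f b < 0"
  obtains x where "a < x" "x < b" "f x = 0"
proof -
  have "\<exists>x\<ge>a. x \<le> b \<and> s * f x = 0"
    using assms by (intro IVT2') (auto intro!: continuous_intros)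
  then obtain x where x: "a \<le> x" "x \<le> b" "s * f x = 0" by blast
  have "s \<noteq> 0" using assms(3) by auto
  then have "f x = 0" using x(3) by simp
  moreover have "x \<noteq> a" "x \<noteq> b" using assms(3,4) x(3) by auto
  ultimately show ?thesis using that x by (metis order_le_less)
qed

lemma branch_II:
  assumes "0 < M"
  shows "branch M (DCT_II M) (\<lambda>n. real n * pi / real M) 1"
proof
  show "0 < M" by (rule assms)
  show "DCT_II M \<in> carrier_mat M M" by (simp add: DCT_II_def)
  show "DCT_II M * transpose_mat (DCT_II M) = 1\<^sub>m M" by (rule DCT_II_orthogonal)
  show "DCT_II M * tridiag M 2 1 1 1 = mat_diag M (\<lambda>n. 2 - 2 * cos (real n * pi / real M)) * DCT_II M"
    by (rule DCT_II_tridiag)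
  fix \<rho> :: real and i assume \<rho>: "0 < \<rho>" "\<rho> < 1" and i: "i < M"
  \<comment> \<open>\<open>f \<theta>\<close> is the boundary defect
    \<open>x (-1) - \<rho> * x 0\<close> of the cosine mode \<open>x\<close> introduced
    below.\<close>
  define f where "f \<theta> = cos (real M * \<theta> + \<theta> / 2) - \<rho> * cos (real M * \<theta> - \<theta> / 2)" for \<theta> :: real
  define a b where "a = real i * pi / real M" and "b = a + pi / (2 * real M)"
  have sgn: "(-1) ^ i * (-1) ^ i = (1 :: real)" by (simp flip: power_mult_distrib)
  \<comment> \<open>Multiplied by \<open>M\<close>, the cell becomes the quarter period from
    \<open>i * pi\<close> to \<open>i * pi + pi / 2\<close>, so the addition formulas pull out the
    sign \<open>(-1) ^ i\<close> at both ends.\<close>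
  have Ma: "real M * a = real i * pi" and Mb: "real M * b = real i * pi + pi / 2"
    using assms by (simp_all add: a_def b_def field_simps)
  have bounds: "0 \<le> a" "a < b" "b < pi"
  proof -
    have "(real i + 1 / 2) * pi < real M * pi"
      using i by (intro mult_strict_right_mono) auto
    then have "real M * b < real M * pi" unfolding Mb by (simp add: distrib_right)
    then show "b < pi" using assms by simp
  qed (use assms in \<open>auto simp: a_def b_def\<close>)
  have "f a = (-1) ^ i * (cos (a / 2) * (1 - \<rho>))"
    unfolding f_def Ma by (simp add: cos_add cos_diff algebra_simps)
  moreover have "cos (a / 2) > 0" using bounds by (intro cos_gt_zero_pi) auto
  ultimately have fa: "0 < (-1) ^ i * f a" using \<rho> sgn by (simp flip: mult.assoc)
  have "f b = (-1) ^ i * (- (sin (b / 2) * (1 + \<rho>)))"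
    unfolding f_def Mb by (simp add: cos_add cos_diff sin_add algebra_simps)
  moreover have "sin (b / 2) > 0" using bounds by (intro sin_gt_zero) auto
  ultimately have fb: "(-1) ^ i * f b < 0" using \<rho> sgn by (simp flip: mult.assoc)
  have "continuous_on {a..b} f" unfolding f_def by (intro continuous_intros) auto
  then obtain \<theta> where \<theta>: "a < \<theta>" "\<theta> < b" "f \<theta> = 0"
    by (rule root_between[OF bounds(2) _ fa fb])
  define x where "x k = cos (\<theta> * (of_int k - real M + 1 / 2))" for k :: int
  have "x (- 1) = \<rho> * x 0"
  proof -
    have "x (- 1) = cos (real M * \<theta> + \<theta> / 2)" "x 0 = cos (real M * \<theta> - \<theta> / 2)"
      unfolding x_def by (subst cos_minus[symmetric], rule arg_cong[of _ _ cos], simp add: field_simps)+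
    then show ?thesis using \<theta>(3) by (simp add: f_def)
  qed
  moreover have "x (int M) = 1 * x (int M - 1)"
    by (simp add: x_def)
  moreover have "x (k - 1) + x (k + 1) = 2 * cos \<theta> * x k" for k
  proof -
    have "x (k - 1) = cos (\<theta> * (of_int k - real M + 1 / 2) - \<theta>)"
      "x (k + 1) = cos (\<theta> * (of_int k - real M + 1 / 2) + \<theta>)"
      unfolding x_def by (rule arg_cong[of _ _ cos], simp add: algebra_simps)+
    then show ?thesis by (simp add: x_def cos_add cos_diff)
  qed
  \<comment> \<open>The entry next to the centre is \<open>cos (\<theta> / 2)\<close>, positive
    because \<open>\<theta> < pi\<close>; this excludes the zero sequence.\<close>
  moreover have "x (int (M - 1)) \<noteq> 0"
  proof -
    have "x (int (M - 1)) = cos (\<theta> / 2)" using assms by (simp add: x_def of_nat_diff)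
    moreover have "cos (\<theta> / 2) > 0" using bounds \<theta> by (intro cos_gt_zero) auto
    ultimately show ?thesis by simp
  qed
  then have "\<exists>k<M. x (int k) \<noteq> 0" using assms by (intro exI[of _ "M - 1"]) auto
  ultimately show "\<exists>\<theta> x. real i * pi / real M < \<theta> \<and> \<theta> < real i * pi / real M + pi / (2 * real M) \<and>
        x (- 1) = \<rho> * x 0 \<and> x (int M) = 1 * x (int M - 1) \<and>
        (\<forall>k. x (k - 1) + x (k + 1) = 2 * cos \<theta> * x k) \<and> (\<exists>k<M. x (int k) \<noteq> 0)"
    using \<theta>(1,2) unfolding a_def b_def by blast
qed (use assms in \<open>auto simp: field_simps\<close>)

lemma branch_IV:
  assumes "0 < M"
  shows "branch M (DCT_IV M) (\<lambda>n. (2 * real n + 1) * pi / (2 * real M)) (-1)"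
proof
  show "0 < M" by (rule assms)
  show "DCT_IV M \<in> carrier_mat M M" by (simp add: DCT_IV_def)
  show "DCT_IV M * transpose_mat (DCT_IV M) = 1\<^sub>m M" by (rule DCT_IV_orthogonal)
  show "DCT_IV M * tridiag M 2 1 1 (-1) =
      mat_diag M (\<lambda>n. 2 - 2 * cos ((2 * real n + 1) * pi / (2 * real M))) * DCT_IV M"
    by (rule DCT_IV_tridiag)
  fix \<rho> :: real and i assume \<rho>: "0 < \<rho>" "\<rho> < 1" and i: "i < M"
  \<comment> \<open>Because the sine is odd, this is the boundary defect with reversed sign,
    \<open>\<rho> * x 0 - x (-1)\<close>.\<close>
  define f where "f \<theta> = sin (real M * \<theta> + \<theta> / 2) - \<rho> * sin (real M * \<theta> - \<theta> / 2)" for \<theta> :: real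
  define a b where "a = (2 * real i + 1) * pi / (2 * real M)" and "b = a + pi / (2 * real M)"
  have sgn: "(-1) ^ i * (-1) ^ i = (1 :: real)" by (simp flip: power_mult_distrib)
  \<comment> \<open>The quarter period is shifted by one cell against the even branch. The last cell
    ends exactly at \<open>pi\<close>, where \<open>sin (b / 2)\<close> is still positive.\<close>
  have Ma: "real M * a = real i * pi + pi / 2" and Mb: "real M * b = real i * pi + pi"
    using assms by (simp_all add: a_def b_def field_simps)
  have bounds: "0 < a" "a < b" "b \<le> pi"
  proof -
    have "(real i + 1) * pi \<le> real M * pi"
      using i by (intro mult_right_mono) auto
    then have "real M * b \<le> real M * pi" unfolding Mb by (simp add: distrib_right)
    then show "b \<le> pi" using assms by simp
  qed (use assms in \<open>auto simp: a_def b_def\<close>)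
  have "f a = (-1) ^ i * (cos (a / 2) * (1 - \<rho>))"
    unfolding f_def Ma by (simp add: sin_add sin_diff cos_add algebra_simps)
  moreover have "cos (a / 2) > 0" using bounds by (intro cos_gt_zero_pi) auto
  ultimately have fa: "0 < (-1) ^ i * f a" using \<rho> sgn by (simp flip: mult.assoc)
  have "f b = (-1) ^ i * (- (sin (b / 2) * (1 + \<rho>)))"
    unfolding f_def Mb by (simp add: cos_add sin_add sin_diff algebra_simps)
  moreover have "sin (b / 2) > 0" using bounds by (intro sin_gt_zero) auto
  ultimately have fb: "(-1) ^ i * f b < 0" using \<rho> sgn by (simp flip: mult.assoc)
  have "continuous_on {a..b} f" unfolding f_def by (intro continuous_intros) auto
  then obtain \<theta> where \<theta>: "a < \<theta>" "\<theta> < b" "f \<theta> = 0"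
    by (rule root_between[OF bounds(2) _ fa fb])
  define x where "x k = sin (\<theta> * (of_int k - real M + 1 / 2))" for k :: int
  have "x (- 1) = \<rho> * x 0"
  proof -
    have "- x (- 1) = sin (real M * \<theta> + \<theta> / 2)" "- x 0 = sin (real M * \<theta> - \<theta> / 2)"
      unfolding x_def by (subst sin_minus[symmetric], rule arg_cong[of _ _ sin], simp add: field_simps)+
    then have "x (- 1) = - (\<rho> * sin (real M * \<theta> - \<theta> / 2))" "x 0 = - sin (real M * \<theta> - \<theta> / 2)"
      using \<theta>(3) by (simp_all add: f_def)
    then show ?thesis by simp
  qed
  moreover have "x (int M) = - 1 * x (int M - 1)"
    by (simp add: x_def)
  moreover have "x (k - 1) + x (k + 1) = 2 * cos \<theta> * x k" for k
  proof -
    have "x (k - 1) = sin (\<theta> * (of_int k - real M + 1 / 2) - \<theta>)"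
      "x (k + 1) = sin (\<theta> * (of_int k - real M + 1 / 2) + \<theta>)"
      unfolding x_def by (rule arg_cong[of _ _ sin], simp add: algebra_simps)+
    then show ?thesis by (simp add: x_def sin_add sin_diff)
  qed
  moreover have "x (int (M - 1)) \<noteq> 0"
  proof -
    have "x (int (M - 1)) = - sin (\<theta> / 2)" using assms by (simp add: x_def of_nat_diff)
    moreover have "sin (\<theta> / 2) > 0" using bounds \<theta> by (intro sin_gt_zero) auto
    ultimately show ?thesis by simp
  qed
  then have "\<exists>k<M. x (int k) \<noteq> 0" using assms by (intro exI[of _ "M - 1"]) auto
  ultimately show "\<exists>\<theta> x. (2 * real i + 1) * pi / (2 * real M) < \<theta> \<and>
        \<theta> < (2 * real i + 1) * pi / (2 * real M) + pi / (2 * real M) \<and>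
        x (- 1) = \<rho> * x 0 \<and> x (int M) = - 1 * x (int M - 1) \<and>
        (\<forall>k. x (k - 1) + x (k + 1) = 2 * cos \<theta> * x k) \<and> (\<exists>k<M. x (int k) \<noteq> 0)"
    using \<theta>(1,2) unfolding a_def b_def by blast
qed (use assms in \<open>auto simp: field_simps\<close>)

section \<open>Butterfly and interleaving\<close>

lemma block_diag_carrier [simp]:
  "A \<in> carrier_mat M M \<Longrightarrow> D \<in> carrier_mat M M \<Longrightarrow> block_diag A D \<in> carrier_mat (2 * M) (2 * M)"
  unfolding block_diag_def by (rule carrier_matI) (auto simp: mult_2)

lemma block_diag_mult:
  assumes "A \<in> carrier_mat M M" "D \<in> carrier_mat M M" "A' \<in> carrier_mat M M" "D' \<in> carrier_mat M M"
  shows "block_diag A D * block_diag A' D' = block_diag (A * A') (D * D')"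
proof -
  have z: "0\<^sub>m M M \<in> carrier_mat M M" by simp
  show ?thesis
    using assms mult_four_block_mat[OF assms(1) z z assms(2) assms(3) z z assms(4)]
    by (simp add: block_diag_def)
qed

lemma transpose_block_diag:
  assumes "A \<in> carrier_mat M M" "D \<in> carrier_mat M M"
  shows "transpose_mat (block_diag A D) = block_diag (transpose_mat A) (transpose_mat D)"
  using assms transpose_four_block_mat[of A M M "0\<^sub>m M M" M "0\<^sub>m M M" M D]
  by (simp add: block_diag_def)

lemma block_diag_one: "block_diag (1\<^sub>m M) (1\<^sub>m M) = (1\<^sub>m (2 * M) :: real mat)"
  by (simp add: block_diag_def mult_2)

lemma block_diag_index:
  assumes "A \<in> carrier_mat M M" "D \<in> carrier_mat M M" "i < 2 * M" "j < 2 * M"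
  shows "block_diag A D $$ (i, j) = (if i < M then if j < M then A $$ (i, j) else 0
    else if j < M then 0 else D $$ (i - M, j - M))"
  using assms by (simp add: block_diag_def)

text \<open>Row \<open>i\<close> of the butterfly is \<open>(e\<^sub>p \<plusminus> e\<^sub>2\<^sub>M\<^sub>-\<^sub>1\<^sub>-\<^sub>p) / \<surd>2\<close> with \<open>p = i mod M\<close>.\<close>

definition half :: "nat \<Rightarrow> nat \<Rightarrow> nat" where "half M i = (if i < M then i else i - M)"
definition parity :: "nat \<Rightarrow> nat \<Rightarrow> real" where "parity M i = (if i < M then 1 else -1)"

lemma half_less: "i < 2 * M \<Longrightarrow> half M i < M" by (auto simp: half_def)

lemma butterfly_carrier [simp]: "butterfly (2 * M) \<in> carrier_mat (2 * M) (2 * M)"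
  by (auto simp: butterfly_def counter_id_def Let_def)

lemma butterfly_index:
  assumes "i < 2 * M" "j < 2 * M"
  shows "butterfly (2 * M) $$ (i, j) =
    ((if j = half M i then 1 else 0) + parity M i * (if j = 2 * M - 1 - half M i then 1 else 0)) / sqrt 2"
proof -
  have "butterfly (2 * M) $$ (i, j) = (if j < M then if half M i = j then 1 else 0
      else parity M i * (if half M i + (j - M) + 1 = M then 1 else 0)) / sqrt 2"
    using assms
    by (cases "i < M"; cases "j < M")
      (simp_all add: butterfly_def counter_id_def half_def parity_def Let_def)
  moreover have "j = 2 * M - 1 - half M i \<longleftrightarrow> \<not> j < M \<and> half M i + (j - M) + 1 = M"
    using half_less[OF assms(1)] assms(2) by arith
  moreover have "j = half M i \<longrightarrow> j < M" using half_less[OF assms(1)] by simp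
  ultimately show ?thesis by (cases "j < M") auto
qed

lemma butterfly_sum:
  assumes "i < 2 * M"
  shows "(\<Sum>k<2 * M. butterfly (2 * M) $$ (i, k) * f k) =
    (f (half M i) + parity M i * f (2 * M - 1 - half M i)) / sqrt 2"
proof -
  have "(\<Sum>k<2 * M. butterfly (2 * M) $$ (i, k) * f k) =
    (\<Sum>k<2 * M. (if k = half M i then f (half M i) / sqrt 2 else 0) +
      (if k = 2 * M - 1 - half M i then parity M i * f (2 * M - 1 - half M i) / sqrt 2 else 0))"
    using assms by (intro sum.cong refl) (auto simp: butterfly_index add_divide_distrib distrib_right)
  also have "\<dots> = (f (half M i) + parity M i * f (2 * M - 1 - half M i)) / sqrt 2"
    using half_less[OF assms] by (simp add: sum.distrib add_divide_distrib)
  finally show ?thesis .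
qed

lemma mult_butterfly_transpose:
  assumes "X \<in> carrier_mat n (2 * M)" "i < n" "j < 2 * M"
  shows "(X * transpose_mat (butterfly (2 * M))) $$ (i, j) =
    (X $$ (i, half M j) + parity M j * X $$ (i, 2 * M - 1 - half M j)) / sqrt 2"
proof -
  have "(X * transpose_mat (butterfly (2 * M))) $$ (i, j) =
      (\<Sum>k<2 * M. butterfly (2 * M) $$ (j, k) * X $$ (i, k))"
    using assms carrier_matD[OF butterfly_carrier[of M]]
    by (simp add: scalar_prod_def lessThan_atLeast0 mult.commute)
  then show ?thesis unfolding butterfly_sum[OF assms(3)] .
qed

lemma butterfly_mult:
  assumes "X \<in> carrier_mat (2 * M) n" "i < 2 * M" "j < n"
  shows "(butterfly (2 * M) * X) $$ (i, j) =
    (X $$ (half M i, j) + parity M i * X $$ (2 * M - 1 - half M i, j)) / sqrt 2"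
proof -
  have "(butterfly (2 * M) * X) $$ (i, j) = (\<Sum>k<2 * M. butterfly (2 * M) $$ (i, k) * X $$ (k, j))"
    using assms carrier_matD[OF butterfly_carrier[of M]]
    by (simp add: scalar_prod_def lessThan_atLeast0)
  then show ?thesis unfolding butterfly_sum[OF assms(2)] .
qed

lemma butterfly_orthogonal:
  "butterfly (2 * M) * transpose_mat (butterfly (2 * M)) = 1\<^sub>m (2 * M)"
proof (rule eq_matI)
  fix i j assume "i < dim_row (1\<^sub>m (2 * M))" "j < dim_col (1\<^sub>m (2 * M))"
  then have ij: "i < 2 * M" "j < 2 * M" by auto
  have eq: "i = j \<longleftrightarrow> half M i = half M j \<and> parity M i = parity M j"
    using ij by (auto simp: half_def parity_def)
  show "(butterfly (2 * M) * transpose_mat (butterfly (2 * M))) $$ (i, j) = 1\<^sub>m (2 * M) $$ (i, j)"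
    using half_less[OF ij(1)] half_less[OF ij(2)] ij eq
    by (auto simp: mult_butterfly_transpose[OF butterfly_carrier] butterfly_index parity_def
        real_div_sqrt)
qed (simp_all add: carrier_matD[OF butterfly_carrier])

text \<open>Reversing the order exchanges the two corners, which carry the same weight.\<close>

lemma tridiag_centrosymmetric:
  assumes "i < n" "j < n"
  shows "tridiag n b r \<alpha> \<alpha> $$ (n - 1 - i, n - 1 - j) = tridiag n b r \<alpha> \<alpha> $$ (i, j)"
proof -
  have iff: "n - 1 - i = n - 1 - j \<longleftrightarrow> i = j" "n - 1 - i = 0 \<longleftrightarrow> i + 1 = n" "n - 1 - i + 1 = n \<longleftrightarrow> i = 0"
    "n - 1 - j = n - 1 - i + 1 \<longleftrightarrow> i = j + 1" "n - 1 - i = n - 1 - j + 1 \<longleftrightarrow> j = i + 1"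
    using assms by linarith+
  have "n - 1 - i < n" "n - 1 - j < n" using assms by linarith+
  then show ?thesis using assms unfolding tridiag_def by (simp only: index_mat prod.case iff) simp
qed

text \<open>The halves of the long matrix are coupled only between the indices \<open>M - 1\<close>
  and \<open>M\<close>. Folding moves that coupling onto the diagonal entry \<open>M - 1\<close>,
  where it becomes the inner corner weight \<open>\<beta>\<close>.\<close>

lemma tridiag_fold:
  assumes "p < M" "q < M"
  shows "tridiag M b r \<alpha> \<beta> $$ (p, q) =
    tridiag (2 * M) b r \<alpha> \<alpha> $$ (p, q) + \<beta> * tridiag (2 * M) b r \<alpha> \<alpha> $$ (p, 2 * M - 1 - q)"
proof -
  have iff: "p = 2 * M - 1 - q \<longleftrightarrow> False" "2 * M - 1 - q = p + 1 \<longleftrightarrow> p = q \<and> p + 1 = M"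
    "p = 2 * M - 1 - q + 1 \<longleftrightarrow> False" "p + 1 = 2 * M \<longleftrightarrow> False"
    using assms by arith+
  have "p < 2 * M" "q < 2 * M" "2 * M - 1 - q < 2 * M" using assms by linarith+
  then show ?thesis using assms unfolding tridiag_def by (simp only: index_mat prod.case iff) simp
qed

text \<open>By centrosymmetry an entry combines \<open>?T $$ (p, q)\<close> and its folded partner
  with coefficients \<open>(1 + s * t) / 2\<close> and \<open>(s + t) / 2\<close>, for row and
  column parities \<open>s\<close> and \<open>t\<close>. Both vanish for opposite parities; for
  \<open>s = t\<close> they are 1 and \<open>s\<close>, the combination in
  \<open>tridiag_fold\<close>.\<close>

lemma butterfly_conj_tridiag:
  assumes "0 < M"
  shows "butterfly (2 * M) * tridiag (2 * M) b r \<rho> \<rho> * transpose_mat (butterfly (2 * M)) =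
    block_diag (tridiag M b r \<rho> 1) (tridiag M b r \<rho> (-1))"
proof (rule eq_matI)
  let ?T = "tridiag (2 * M) b r \<rho> \<rho>"
  fix i j
  assume "i < dim_row (block_diag (tridiag M b r \<rho> 1) (tridiag M b r \<rho> (-1)))"
    "j < dim_col (block_diag (tridiag M b r \<rho> 1) (tridiag M b r \<rho> (-1)))"
  then have ij: "i < 2 * M" "j < 2 * M" by (auto simp: block_diag_def)
  define p q where "p = half M i" and "q = half M j"
  have pq: "p < M" "q < M" using half_less ij by (auto simp: p_def q_def)
  have BT: "butterfly (2 * M) * ?T \<in> carrier_mat (2 * M) (2 * M)" by (rule mult_carrier_mat[OF butterfly_carrier]) simp
  have centro: "?T $$ (2 * M - 1 - p, 2 * M - 1 - q) = ?T $$ (p, q)"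
    "?T $$ (2 * M - 1 - p, q) = ?T $$ (p, 2 * M - 1 - q)"
    using tridiag_centrosymmetric[of p "2 * M" q] tridiag_centrosymmetric[of p "2 * M" "2 * M - 1 - q"] pq
    by simp_all
  have "(butterfly (2 * M) * ?T * transpose_mat (butterfly (2 * M))) $$ (i, j) =
      ((1 + parity M i * parity M j) * ?T $$ (p, q) +
       (parity M i + parity M j) * ?T $$ (p, 2 * M - 1 - q)) / 2"
  proof -
    have less: "q < 2 * M" "2 * M - 1 - q < 2 * M" using pq by linarith+
    have double: "(x / sqrt 2 + y / sqrt 2) / sqrt 2 = (x + y) / 2" for x y :: real
      by (simp add: add_divide_distrib)
    have "(butterfly (2 * M) * ?T * transpose_mat (butterfly (2 * M))) $$ (i, j) =
        (((?T $$ (p, q) + parity M i * ?T $$ (p, 2 * M - 1 - q)) / sqrt 2) +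
         (parity M j * (?T $$ (p, 2 * M - 1 - q) + parity M i * ?T $$ (p, q))) / sqrt 2) / sqrt 2"
      unfolding mult_butterfly_transpose[OF BT ij] q_def[symmetric]
        butterfly_mult[OF tridiag_carrier(1) ij(1) less(1)] butterfly_mult[OF tridiag_carrier(1) ij(1) less(2)]
        p_def[symmetric] centro by (simp only: times_divide_eq_right)
    then show ?thesis unfolding double by (simp add: algebra_simps)
  qed
  also have "\<dots> = block_diag (tridiag M b r \<rho> 1) (tridiag M b r \<rho> (-1)) $$ (i, j)"
    using ij tridiag_fold[OF pq, of b r \<rho>]
    by (cases "i < M"; cases "j < M")
      (simp_all add: block_diag_index[OF tridiag_carrier(1) tridiag_carrier(1)] p_def q_def half_def parity_def)
  finally show "(butterfly (2 * M) * ?T * transpose_mat (butterfly (2 * M))) $$ (i, j) =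
      block_diag (tridiag M b r \<rho> 1) (tridiag M b r \<rho> (-1)) $$ (i, j)" .
qed (simp_all add: carrier_matD[OF butterfly_carrier]
    carrier_matD[OF block_diag_carrier[OF tridiag_carrier(1) tridiag_carrier(1)]])

text \<open>Polymorphic because indices are interleaved as well as angles, eigenvalues and signs:
  \<open>interleaved id ((+) M)\<close> sends a row of the permutation matrix to the column of its
  entry 1.\<close>

definition interleaved :: "(nat \<Rightarrow> 'a) \<Rightarrow> (nat \<Rightarrow> 'a) \<Rightarrow> nat \<Rightarrow> 'a" where
  "interleaved f g r = (if even r then f (r div 2) else g (r div 2))"

lemma interleave_carrier [simp]: "interleave N \<in> carrier_mat N N"
  by (simp add: interleave_def Let_def)

lemma interleave_index:
  assumes "r < 2 * M" "c < 2 * M"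
  shows "interleave (2 * M) $$ (r, c) = (if c = interleaved id ((+) M) r then 1 else 0)"
proof -
  have "(\<exists>i<M. r = 2 * i \<and> c = i \<or> r = 2 * i + 1 \<and> c = M + i) \<longleftrightarrow> c = interleaved id ((+) M) r"
    (is "?l = ?r")
  proof
    assume ?r
    then show ?l using assms(1) by (intro exI[of _ "r div 2"]) (auto simp: interleaved_def split: if_splits)
  qed (auto simp: interleaved_def)
  then show ?thesis using assms by (simp add: interleave_def Let_def)
qed

lemma interleave_mult:
  assumes "X \<in> carrier_mat (2 * M) n" "r < 2 * M" "j < n"
  shows "(interleave (2 * M) * X) $$ (r, j) = X $$ (interleaved id ((+) M) r, j)"
proof -
  have less: "interleaved id ((+) M) r < 2 * M" using assms(2) by (auto simp: interleaved_def)
  have "(interleave (2 * M) * X) $$ (r, j) = (\<Sum>k<2 * M. interleave (2 * M) $$ (r, k) * X $$ (k, j))"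
    using assms carrier_matD[OF interleave_carrier[of "2 * M"]]
    by (simp add: scalar_prod_def lessThan_atLeast0)
  also have "\<dots> = (\<Sum>k<2 * M. if k = interleaved id ((+) M) r then X $$ (k, j) else 0)"
    using assms(2) by (intro sum.cong refl) (simp add: interleave_index)
  finally show ?thesis using less by simp
qed

lemma interleave_orthogonal:
  "interleave (2 * M) * transpose_mat (interleave (2 * M)) = 1\<^sub>m (2 * M)"
proof (rule eq_matI)
  fix i j assume "i < dim_row (1\<^sub>m (2 * M))" "j < dim_col (1\<^sub>m (2 * M))"
  then have ij: "i < 2 * M" "j < 2 * M" by auto
  have less: "interleaved id ((+) M) i < 2 * M" using ij by (auto simp: interleaved_def)
  have inj: "interleaved id ((+) M) i = interleaved id ((+) M) j \<longleftrightarrow> i = j"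
  proof
    assume eq: "interleaved id ((+) M) i = interleaved id ((+) M) j"
    have "i div 2 < M" "j div 2 < M" using ij by auto
    then have "even i = even j" "i div 2 = j div 2"
      using eq by (auto simp: interleaved_def split: if_splits)
    then show "i = j" by (metis div_mult_mod_eq even_iff_mod_2_eq_zero odd_iff_mod_2_eq_one)
  qed simp
  have "(interleave (2 * M) * transpose_mat (interleave (2 * M))) $$ (i, j) =
      transpose_mat (interleave (2 * M)) $$ (interleaved id ((+) M) i, j)"
    by (rule interleave_mult[OF _ ij]) simp
  then show "(interleave (2 * M) * transpose_mat (interleave (2 * M))) $$ (i, j) = 1\<^sub>m (2 * M) $$ (i, j)"
    using ij less inj carrier_matD[OF interleave_carrier[of "2 * M"]]
    by (simp add: interleave_index del: index_mult_mat)
qed (simp_all add: carrier_matD[OF interleave_carrier])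

lemma interleave_diag:
  "interleave (2 * M) * block_diag (mat_diag M f) (mat_diag M g) =
    mat_diag (2 * M) (interleaved f g) * interleave (2 * M)"
proof (rule eq_matI)
  fix r c
  assume "r < dim_row (mat_diag (2 * M) (interleaved f g) * interleave (2 * M))"
    "c < dim_col (mat_diag (2 * M) (interleaved f g) * interleave (2 * M))"
  then have rc: "r < 2 * M" "c < 2 * M" by (auto simp: carrier_matD[OF interleave_carrier])
  have less: "interleaved id ((+) M) r < 2 * M" using rc by (auto simp: interleaved_def)
  show "(interleave (2 * M) * block_diag (mat_diag M f) (mat_diag M g)) $$ (r, c) =
      (mat_diag (2 * M) (interleaved f g) * interleave (2 * M)) $$ (r, c)"
    unfolding interleave_mult[OF block_diag_carrier[OF mat_diag_dim mat_diag_dim] rc]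
      mult_mat_diag_index(1)[OF interleave_carrier rc] interleave_index[OF rc]
      block_diag_index[OF mat_diag_dim mat_diag_dim less rc(2)]
    using rc by (auto simp: interleaved_def mat_diag_def)
qed (simp_all add: carrier_matD[OF interleave_carrier]
    carrier_matD[OF block_diag_carrier[OF mat_diag_dim mat_diag_dim]])

text \<open>The diagonals are arbitrary: they are row signs in \<open>fast_form_signs\<close> and
  eigenvalues in \<open>eigenframe_interleave\<close>.\<close>

lemma interleave_signs:
  assumes "X \<in> carrier_mat M M" "Y \<in> carrier_mat M M"
  shows "interleave (2 * M) * block_diag (mat_diag M f * X) (mat_diag M g * Y) =
    mat_diag (2 * M) (interleaved f g) * (interleave (2 * M) * block_diag X Y)"
proof -
  let ?D = "block_diag (mat_diag M f) (mat_diag M g)"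
  have D: "?D \<in> carrier_mat (2 * M) (2 * M)" and K: "block_diag X Y \<in> carrier_mat (2 * M) (2 * M)"
    using assms by simp_all
  have "interleave (2 * M) * block_diag (mat_diag M f * X) (mat_diag M g * Y) =
      interleave (2 * M) * (?D * block_diag X Y)"
    by (simp add: block_diag_mult[OF mat_diag_dim mat_diag_dim assms])
  also have "\<dots> = (interleave (2 * M) * ?D) * block_diag X Y"
    by (rule assoc_mult_mat[symmetric, OF interleave_carrier D K])
  also have "\<dots> = mat_diag (2 * M) (interleaved f g) * (interleave (2 * M) * block_diag X Y)"
    unfolding interleave_diag by (rule assoc_mult_mat[OF mat_diag_dim interleave_carrier K])
  finally show ?thesis .
qed

lemma eigenframe_conj:
  assumes "eigenframe n A \<mu> Q" "C \<in> carrier_mat n n" "C * transpose_mat C = 1\<^sub>m n"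
  shows "eigenframe n (transpose_mat C * A * C) \<mu> (Q * C)"
proof -
  have c: "A \<in> carrier_mat n n" "Q \<in> carrier_mat n n" "transpose_mat C \<in> carrier_mat n n"
    "transpose_mat A = A" and Q: "Q * transpose_mat Q = 1\<^sub>m n" "Q * A = mat_diag n \<mu> * Q"
    using assms by (auto simp: eigenframe_def)
  note assoc = assoc_mult_mat[of _ n n _ n _ n]
  have "(Q * C) * transpose_mat (Q * C) = Q * (C * transpose_mat C) * transpose_mat Q"
    using c assms(2) by (simp add: assoc transpose_mult[of _ n n _ n])
  then have 1: "(Q * C) * transpose_mat (Q * C) = 1\<^sub>m n" using c Q by (simp add: assms(3))
  have "(Q * C) * (transpose_mat C * A * C) = (Q * (C * transpose_mat C)) * A * C"
    using c assms(2) by (simp add: assoc)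
  also have "\<dots> = (Q * A) * C" using c by (simp add: assms(3))
  also have "\<dots> = mat_diag n \<mu> * (Q * C)" using c assms(2) by (simp add: Q(2) assoc)
  finally have 2: "(Q * C) * (transpose_mat C * A * C) = mat_diag n \<mu> * (Q * C)" .
  have 3: "transpose_mat (transpose_mat C * A * C) = transpose_mat C * A * C"
    using c assms(2) by (simp add: assoc transpose_mult[of _ n n _ n])
  show ?thesis using 1 2 3 c assms(2) by (simp add: eigenframe_def)
qed

lemma eigenframe_interleave:
  assumes "eigenframe M A \<mu> X" "eigenframe M B \<nu> Y"
  shows "eigenframe (2 * M) (block_diag A B) (interleaved \<mu> \<nu>) (interleave (2 * M) * block_diag X Y)"
proof -
  have c: "A \<in> carrier_mat M M" "X \<in> carrier_mat M M" "B \<in> carrier_mat M M" "Y \<in> carrier_mat M M"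
    and t: "transpose_mat A = A" "transpose_mat B = B"
    and o: "X * transpose_mat X = 1\<^sub>m M" "Y * transpose_mat Y = 1\<^sub>m M"
    and e: "X * A = mat_diag M \<mu> * X" "Y * B = mat_diag M \<nu> * Y"
    using assms by (auto simp: eigenframe_def)
  let ?P = "interleave (2 * M)" and ?K = "block_diag X Y"
  have K: "?K \<in> carrier_mat (2 * M) (2 * M)" and P: "?P \<in> carrier_mat (2 * M) (2 * M)"
    and AB: "block_diag A B \<in> carrier_mat (2 * M) (2 * M)"
    and Kt: "transpose_mat ?K \<in> carrier_mat (2 * M) (2 * M)"
    and Pt: "transpose_mat ?P \<in> carrier_mat (2 * M) (2 * M)"
    using c by simp_all
  note assoc = assoc_mult_mat[of _ "2 * M" "2 * M" _ "2 * M" _ "2 * M"]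
  have KK: "?K * transpose_mat ?K = 1\<^sub>m (2 * M)"
    using c o by (simp add: transpose_block_diag block_diag_mult block_diag_one)
  have "(?P * ?K) * transpose_mat (?P * ?K) = ?P * (?K * transpose_mat ?K) * transpose_mat ?P"
    using K P Kt Pt by (simp add: assoc transpose_mult[OF P K])
  then have 1: "(?P * ?K) * transpose_mat (?P * ?K) = 1\<^sub>m (2 * M)"
    using P by (simp add: KK interleave_orthogonal)
  have "(?P * ?K) * block_diag A B = ?P * (?K * block_diag A B)"
    by (rule assoc_mult_mat[OF P K AB])
  also have "?K * block_diag A B = block_diag (mat_diag M \<mu> * X) (mat_diag M \<nu> * Y)"
    using c e by (simp add: block_diag_mult)
  finally have 2: "(?P * ?K) * block_diag A B = mat_diag (2 * M) (interleaved \<mu> \<nu>) * (?P * ?K)"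
    using c by (simp add: interleave_signs)
  have 3: "transpose_mat (block_diag A B) = block_diag A B" using c t by (simp add: transpose_block_diag)
  show ?thesis unfolding eigenframe_def using 1 2 3 AB mult_carrier_mat[OF P K] by blast
qed

text \<open>Multiplying the eigenvalue identity by \<open>R\<close> gives
  \<open>mat_diag n \<mu> * (Q * R) = c \<cdot>\<^sub>m Q\<close>, which is divided row by row. It
  leads from the precision matrix to the covariance; for positive \<open>c\<close> and
  \<open>\<mu>\<close> the order of the eigenvalues is reversed.\<close>

lemma eigenframe_inverse:
  assumes "eigenframe n A \<mu> Q" "A * R = c \<cdot>\<^sub>m 1\<^sub>m n" "R \<in> carrier_mat n n" "transpose_mat R = R"
    and nz: "\<And>i. i < n \<Longrightarrow> \<mu> i \<noteq> 0"
  shows "eigenframe n R (\<lambda>i. c / \<mu> i) Q"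
proof -
  have A: "A \<in> carrier_mat n n" and Q: "Q \<in> carrier_mat n n" "Q * A = mat_diag n \<mu> * Q"
    "Q * transpose_mat Q = 1\<^sub>m n"
    using assms(1) by (auto simp: eigenframe_def)
  have QR: "Q * R \<in> carrier_mat n n" using Q assms(3) by simp
  have "mat_diag n \<mu> * (Q * R) = Q * (A * R)"
    using assoc_mult_mat[OF mat_diag_dim[of n \<mu>] Q(1) assms(3)] assoc_mult_mat[OF Q(1) A assms(3)] Q(2)
    by simp
  also have "\<dots> = c \<cdot>\<^sub>m Q" unfolding assms(2) using mult_smult_distrib[OF Q(1) one_carrier_mat[of n]] Q(1) by simp
  finally have eq: "mat_diag n \<mu> * (Q * R) = c \<cdot>\<^sub>m Q" .
  have "Q * R = mat_diag n (\<lambda>i. c / \<mu> i) * Q"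
  proof (rule eq_matI)
    fix i j assume "i < dim_row (mat_diag n (\<lambda>i. c / \<mu> i) * Q)" "j < dim_col (mat_diag n (\<lambda>i. c / \<mu> i) * Q)"
    then have ij: "i < n" "j < n" using Q(1) by auto
    have "\<mu> i * (Q * R) $$ (i, j) = c * Q $$ (i, j)"
      using mult_mat_diag_index(1)[OF QR ij, of \<mu>] ij Q(1) unfolding eq by simp
    then show "(Q * R) $$ (i, j) = (mat_diag n (\<lambda>i. c / \<mu> i) * Q) $$ (i, j)"
      unfolding mult_mat_diag_index(1)[OF Q(1) ij] using nz[OF ij(1)] by (simp add: field_simps)
  qed (use Q(1) assms(3) in auto)
  then show ?thesis using assms(3,4) Q by (simp add: eigenframe_def)
qed

section \<open>Entrywise limits of products and block matrices\<close>

lemma mat_tendsto_mult: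
  assumes "mat_tendsto X A F" "mat_tendsto Y B F" "dim_col A = dim_row B"
  shows "mat_tendsto (\<lambda>t. X t * Y t) (A * B) F"
  unfolding mat_tendsto_def
proof (intro conjI allI impI)
  have ev: "\<forall>\<^sub>F t in F. X t \<in> carrier_mat (dim_row A) (dim_col A) \<and> Y t \<in> carrier_mat (dim_row B) (dim_col B)"
    using assms(1,2) by (simp add: mat_tendsto_def eventually_conj_iff)
  then show "\<forall>\<^sub>F t in F. X t * Y t \<in> carrier_mat (dim_row (A * B)) (dim_col (A * B))"
    by eventually_elim auto
  fix i j assume "i < dim_row (A * B)" "j < dim_col (A * B)"
  then have ij: "i < dim_row A" "j < dim_col B" by auto
  have lim: "((\<lambda>t. \<Sum>k<dim_row B. X t $$ (i, k) * Y t $$ (k, j)) \<longlongrightarrow>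
      (\<Sum>k<dim_row B. A $$ (i, k) * B $$ (k, j))) F"
    using assms ij by (intro tendsto_sum tendsto_mult) (auto simp: mat_tendsto_def)
  have "\<forall>\<^sub>F t in F. (\<Sum>k<dim_row B. X t $$ (i, k) * Y t $$ (k, j)) = (X t * Y t) $$ (i, j)"
    using ev
  proof eventually_elim
    case (elim t)
    then have "dim_row (X t) = dim_row A" "dim_col (X t) = dim_row B"
      "dim_row (Y t) = dim_row B" "dim_col (Y t) = dim_col B"
      using assms(3) by (auto dest: carrier_matD)
    then show ?case using ij by (simp add: scalar_prod_def lessThan_atLeast0)
  qed
  then have "((\<lambda>t. (X t * Y t) $$ (i, j)) \<longlongrightarrow> (\<Sum>k<dim_row B. A $$ (i, k) * B $$ (k, j))) F"
    using lim by (rule Lim_transform_eventually[rotated])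
  then show "((\<lambda>t. (X t * Y t) $$ (i, j)) \<longlongrightarrow> (A * B) $$ (i, j)) F"
    using ij assms(3) by (simp add: scalar_prod_def lessThan_atLeast0)
qed

lemma mat_tendsto_const: "mat_tendsto (\<lambda>_. A) A F"
  unfolding mat_tendsto_def
  by (intro conjI allI impI always_eventually tendsto_const carrier_matI refl)

lemma mat_tendsto_block_diag:
  assumes "mat_tendsto X A F" "mat_tendsto Y B F" "A \<in> carrier_mat M M" "B \<in> carrier_mat M M"
  shows "mat_tendsto (\<lambda>t. block_diag (X t) (Y t)) (block_diag A B) F"
  unfolding mat_tendsto_def
proof (intro conjI allI impI)
  have ev: "\<forall>\<^sub>F t in F. X t \<in> carrier_mat M M \<and> Y t \<in> carrier_mat M M"
    using assms by (simp add: mat_tendsto_def eventually_conj_iff)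
  have d: "dim_row (block_diag A B) = 2 * M" "dim_col (block_diag A B) = 2 * M"
    using carrier_matD[OF block_diag_carrier[OF assms(3,4)]] by auto
  show "\<forall>\<^sub>F t in F. block_diag (X t) (Y t) \<in> carrier_mat (dim_row (block_diag A B)) (dim_col (block_diag A B))"
    unfolding d using ev by eventually_elim simp
  fix i j assume "i < dim_row (block_diag A B)" "j < dim_col (block_diag A B)"
  then have ij: "i < 2 * M" "j < 2 * M" by (simp_all add: d)
  have "((\<lambda>t. if i < M then if j < M then X t $$ (i, j) else 0
      else if j < M then 0 else Y t $$ (i - M, j - M)) \<longlongrightarrow> block_diag A B $$ (i, j)) F"
    unfolding block_diag_index[OF assms(3,4) ij] using assms ij by (auto simp: mat_tendsto_def)
  moreover have "\<forall>\<^sub>F t in F. (if i < M then if j < M then X t $$ (i, j) else 0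
      else if j < M then 0 else Y t $$ (i - M, j - M)) = block_diag (X t) (Y t) $$ (i, j)"
    using ev by eventually_elim (use ij in \<open>simp add: block_diag_index[of _ M]\<close>)
  ultimately show "((\<lambda>t. block_diag (X t) (Y t) $$ (i, j)) \<longlongrightarrow> block_diag A B $$ (i, j)) F"
    by (rule Lim_transform_eventually)
qed

section \<open>The Chen factorization of the DCT-II\<close>

lemma DCT_carrier [simp]: "DCT_II M \<in> carrier_mat M M" "DCT_IV M \<in> carrier_mat M M"
  by (simp_all add: DCT_II_def DCT_IV_def)

text \<open>Reversing the signal multiplies row \<open>r\<close> of the long DCT-II by
  \<open>(-1) ^ r\<close>. So even rows survive only in the sum half of the butterfly and odd rows
  only in the difference half, and \<open>r = 2 * i\<close> and \<open>r = 2 * i + 1\<close> turn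
  its frequencies into those of the DCT-II and DCT-IV of order \<open>M\<close>. Moving the
  butterfly to the other side first makes this an entrywise comparison.\<close>

lemma DCT_II_factorization:
  assumes "0 < M"
  shows "DCT_II (2 * M) = interleave (2 * M) * block_diag (DCT_II M) (DCT_IV M) * butterfly (2 * M)"
proof -
  let ?D = "DCT_II (2 * M)" and ?P = "interleave (2 * M)" and ?B = "butterfly (2 * M)"
    and ?K = "block_diag (DCT_II M) (DCT_IV M)"
  have K: "?K \<in> carrier_mat (2 * M) (2 * M)" by simp
  have "?D * transpose_mat ?B = ?P * ?K"
  proof (rule eq_matI)
    fix r j assume "r < dim_row (?P * ?K)" "j < dim_col (?P * ?K)"
    then have rj: "r < 2 * M" "j < 2 * M"
      using carrier_matD[OF K] carrier_matD[OF interleave_carrier] by auto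
    define i p where "i = r div 2" and "p = half M j"
    have ip: "i < M" "p < M" using rj half_less by (auto simp: i_def p_def)
    define c where "c = (if r = 0 then 1 / sqrt 2 else 1) * sqrt (1 / real M)"
    define a where "a = pi * real r * (2 * real p + 1) / (2 * (2 * real M))"
    have D: "?D $$ (r, k) = c * cos (pi * real r * (2 * real k + 1) / (2 * (2 * real M)))" if "k < 2 * M" for k
      using rj that by (simp add: DCT_II_def c_def)
    have D1: "?D $$ (r, p) = c * cos a" using ip by (simp add: D a_def)
    have D2: "?D $$ (r, 2 * M - 1 - p) = (-1) ^ r * (c * cos a)"
    proof -
      have "pi * real r * (2 * real (2 * M - 1 - p) + 1) / (2 * (2 * real M)) = real r * pi - a"
        using ip by (simp add: a_def of_nat_diff field_simps)
      then show ?thesis using ip by (simp add: D cos_diff)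
    qed
    have "(?D * transpose_mat ?B) $$ (r, j) = (1 + parity M j * (-1) ^ r) / sqrt 2 * (c * cos a)"
      unfolding mult_butterfly_transpose[OF DCT_carrier(1) rj] p_def[symmetric] D1 D2
      by (simp add: algebra_simps add_divide_distrib)
    also have "\<dots> = ?K $$ (interleaved id ((+) M) r, j)"
    proof (cases "(j < M) = even r")
      case True
      have par: "parity M j * (-1) ^ r = 1" using True by (auto simp: parity_def)
      \<comment> \<open>Two equal contributions divided by \<open>sqrt 2\<close> leave a factor
        \<open>sqrt 2\<close>, which turns the normalisation of order \<open>2 * M\<close> into that
        of order \<open>M\<close>.\<close>
      have "sqrt 2 * c = (if r = 0 then 1 / sqrt 2 else 1) * sqrt (2 / real M)"
        by (simp add: c_def real_sqrt_divide)
      then have lhs: "(1 + parity M j * (-1) ^ r) / sqrt 2 * (c * cos a) =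
          (if r = 0 then 1 / sqrt 2 else 1) * sqrt (2 / real M) * cos a"
        unfolding par by (simp add: real_div_sqrt flip: mult.assoc)
      show ?thesis
      proof (cases "even r")
        case even: True
        then have r: "r = 2 * i" by (simp add: i_def)
        have j: "j < M" "p = j" using True even by (auto simp: p_def half_def)
        have "a = pi * real i * (2 * real j + 1) / (2 * real M)" by (simp add: a_def r j(2))
        moreover have "?K $$ (interleaved id ((+) M) r, j) = DCT_II M $$ (i, j)"
          using ip j by (simp add: r interleaved_def block_diag_index[OF DCT_carrier])
        ultimately show ?thesis unfolding lhs using ip j by (simp add: DCT_II_def r)
      next
        case odd: False
        then have r: "r = 2 * i + 1" by (simp add: i_def)
        have j: "\<not> j < M" "p = j - M" using True odd by (auto simp: p_def half_def)
        have "a = pi * (2 * real i + 1) * (2 * real p + 1) / (4 * real M)" by (simp add: a_def r)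
        moreover have "?K $$ (interleaved id ((+) M) r, j) = DCT_IV M $$ (i, p)"
          using ip j rj by (simp add: r interleaved_def block_diag_index[OF DCT_carrier])
        ultimately show ?thesis unfolding lhs using ip by (simp add: DCT_IV_def r)
      qed
    next
      case False
      then have "parity M j * (-1) ^ r = -1" by (auto simp: parity_def)
      then show ?thesis using False rj ip by (auto simp: block_diag_index[OF DCT_carrier] interleaved_def i_def)
    qed
    also have "\<dots> = (?P * ?K) $$ (r, j)" by (rule interleave_mult[symmetric, OF K rj])
    finally show "(?D * transpose_mat ?B) $$ (r, j) = (?P * ?K) $$ (r, j)" .
  qed (simp_all add: carrier_matD[OF butterfly_carrier] carrier_matD[OF interleave_carrier] carrier_matD[OF K]
      carrier_matD[OF DCT_carrier(1)])
  then have "?P * ?K * ?B = (?D * transpose_mat ?B) * ?B" by simp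
  also have "\<dots> = ?D * (transpose_mat ?B * ?B)"
    by (rule assoc_mult_mat[of _ "2 * M" "2 * M" _ "2 * M" _ "2 * M"]) simp_all
  also have "\<dots> = ?D"
    by (simp add: orthogonal_transpose[OF butterfly_carrier butterfly_orthogonal] right_mult_one_mat[OF DCT_carrier(1)])
  finally show ?thesis by simp
qed

section \<open>Assembling the branches\<close>

definition fast_form :: "nat \<Rightarrow> real mat \<Rightarrow> real mat \<Rightarrow> real mat" where
  "fast_form M X Y = interleave (2 * M) * block_diag X Y * butterfly (2 * M)"

lemma fast_form_carrier:
  "X \<in> carrier_mat M M \<Longrightarrow> Y \<in> carrier_mat M M \<Longrightarrow> fast_form M X Y \<in> carrier_mat (2 * M) (2 * M)"
  unfolding fast_form_def
  by (intro mult_carrier_mat[OF mult_carrier_mat[OF interleave_carrier block_diag_carrier] butterfly_carrier])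

lemma fast_form_signs:
  assumes "X \<in> carrier_mat M M" "Y \<in> carrier_mat M M"
  shows "fast_form M (mat_diag M f * X) (mat_diag M g * Y) =
    mat_diag (2 * M) (interleaved f g) * fast_form M X Y"
  unfolding fast_form_def interleave_signs[OF assms]
  by (rule assoc_mult_mat[OF mat_diag_dim mult_carrier_mat[OF interleave_carrier block_diag_carrier[OF assms]]
        butterfly_carrier])

lemma fast_form_tendsto:
  assumes "mat_tendsto X A F" "mat_tendsto Y B F" "A \<in> carrier_mat M M" "B \<in> carrier_mat M M"
  shows "mat_tendsto (\<lambda>t. fast_form M (X t) (Y t)) (fast_form M A B) F"
  unfolding fast_form_def
  by (intro mat_tendsto_mult mat_tendsto_const mat_tendsto_block_diag[OF assms])
    (simp_all add: carrier_matD[OF interleave_carrier] carrier_matD[OF butterfly_carrier]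
      carrier_matD[OF block_diag_carrier[OF assms(3,4)]])

lemma (in branch) eigenframe_T:
  assumes "eigenframe M (G \<rho>) \<mu> Q"
  shows "eigenframe M (T \<rho>) \<mu> (Q * C)"
proof -
  have CT: "C * T \<rho> \<in> carrier_mat M M" using C T_carrier by simp
  have "transpose_mat C * G \<rho> * C = transpose_mat C * (G \<rho> * C)"
    by (rule assoc_mult_mat[OF Ct G_carrier C])
  also have "G \<rho> * C = (C * T \<rho>) * (transpose_mat C * C)"
    unfolding G_def by (rule assoc_mult_mat[OF CT Ct C])
  also have "\<dots> = C * T \<rho>" unfolding Ct_C by (rule right_mult_one_mat[OF CT])
  also have "transpose_mat C * (C * T \<rho>) = (transpose_mat C * C) * T \<rho>"
    by (rule assoc_mult_mat[symmetric, OF Ct C T_carrier])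
  also have "\<dots> = T \<rho>" using T_carrier[of \<rho>] by (simp add: Ct_C)
  finally have "transpose_mat C * G \<rho> * C = T \<rho>" .
  then show ?thesis using eigenframe_conj[OF assms C C_orth] by simp
qed

locale dct_branches =
  fixes M :: nat
  assumes M_pos: "0 < M"
begin

sublocale s: branch M "DCT_II M" "\<lambda>n. real n * pi / real M" 1
  by (rule branch_II[OF M_pos])

sublocale a: branch M "DCT_IV M" "\<lambda>n. (2 * real n + 1) * pi / (2 * real M)" "-1"
  by (rule branch_IV[OF M_pos])

lemma s_eqs: "s.\<Lambda> = Lambda_II M" "s.T \<rho> = T_s M \<rho>" "s.G \<rho> = G_s M \<rho>" "s.D \<rho> = D_s M \<rho>" "s.q = q_s M"
  by (simp_all add: s.\<Lambda>_def s.T_def s.G_def s.D_def s.q_def Lambda_II_def T_s_def G_s_def D_s_def q_s_def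
      L_II_def)

lemma a_eqs: "a.\<Lambda> = Lambda_IV M" "a.T \<rho> = T_a M \<rho>" "a.G \<rho> = G_a M \<rho>" "a.D \<rho> = D_a M \<rho>" "a.q = q_a M"
  by (simp_all add: a.\<Lambda>_def a.T_def a.G_def a.D_def a.q_def Lambda_IV_def T_a_def G_a_def D_a_def q_a_def
      L_IV_def)

lemma butterfly_conj_T_mat:
  assumes "0 < \<rho>" "\<rho> < 1"
  shows "butterfly (2 * M) * T_mat (2 * M) \<rho> * transpose_mat (butterfly (2 * M)) =
    block_diag (T_s M \<rho>) (T_a M \<rho>)"
  unfolding T_mat_eq[OF assms] butterfly_conj_tridiag[OF M_pos]
  by (simp only: s.T_eq[symmetric] a.T_eq[symmetric] s_eqs a_eqs)

text \<open>
  The cells of the two branches tile \<open>[0, \<pi>]\<close> alternately, so interleaving the two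
  increasing spectra yields the increasing spectrum of the full matrix.
\<close>
lemma KLT_eigenframe:
  assumes \<rho>: "0 < \<rho>" "\<rho> < 1"
    and Qs: "increasing_eigenvector_mat (G_s M \<rho>) Qs" and Qa: "increasing_eigenvector_mat (G_a M \<rho>) Qa"
  shows "\<exists>\<nu>. eigenframe (2 * M) (AR1_cov (2 * M) \<rho>) \<nu> (fast_form M (Qs * DCT_II M) (Qa * DCT_IV M)) \<and>
    (\<forall>i j. i < j \<and> j < 2 * M \<longrightarrow> \<nu> j < \<nu> i)"
proof -
  let ?N = "2 * M" and ?B = "butterfly (2 * M)" and ?T = "tridiag (2 * M) (1 + \<rho>\<^sup>2) \<rho> \<rho> \<rho>"
  obtain \<theta>s where \<theta>s: "s.in_cells \<theta>s" "eigenframe M (s.G \<rho>) (\<lambda>i. 1 + \<rho>\<^sup>2 - 2 * \<rho> * cos (\<theta>s i)) Qs"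
    by (rule s.increasing_frame[OF \<rho> Qs[folded s_eqs]])
  obtain \<theta>a where \<theta>a: "a.in_cells \<theta>a" "eigenframe M (a.G \<rho>) (\<lambda>i. 1 + \<rho>\<^sup>2 - 2 * \<rho> * cos (\<theta>a i)) Qa"
    by (rule a.increasing_frame[OF \<rho> Qa[folded a_eqs]])
  define \<theta> where "\<theta> = interleaved \<theta>s \<theta>a"
  define \<mu> where "\<mu> r = 1 + \<rho>\<^sup>2 - 2 * \<rho> * cos (\<theta> r)" for r
  have \<mu>: "interleaved (\<lambda>i. 1 + \<rho>\<^sup>2 - 2 * \<rho> * cos (\<theta>s i)) (\<lambda>i. 1 + \<rho>\<^sup>2 - 2 * \<rho> * cos (\<theta>a i)) = \<mu>"
    by (auto simp: interleaved_def \<mu>_def \<theta>_def)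
  \<comment> \<open>\<open>real r * pi / real ?N\<close> is the frequency of index
    \<open>r div 2\<close> in the branch selected by the parity of \<open>r\<close>, and
    \<open>pi / (2 * M)\<close> is \<open>pi / N\<close>.\<close>
  have cell: "real r * pi / real ?N < \<theta> r \<and> \<theta> r < (real r + 1) * pi / real ?N" if r: "r < ?N" for r
  proof -
    have i: "r div 2 < M" using r by linarith
    show ?thesis
    proof (cases "even r")
      case True
      then have "real r = 2 * real (r div 2)" by auto
      then show ?thesis
        using \<theta>s(1) i True M_pos unfolding s.in_cells_def \<theta>_def interleaved_def
        by (auto simp: field_simps)
    next
      case False
      then have "real r = 2 * real (r div 2) + 1" by (auto elim!: oddE)
      then show ?thesis
        using \<theta>a(1) i False M_pos unfolding a.in_cells_def \<theta>_def interleaved_def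
        by (auto simp: field_simps)
    qed
  qed
  have cos_less: "cos (\<theta> j) < cos (\<theta> i)" if ij: "i < j" "j < ?N" for i j
  proof (rule cos_monotone_0_pi)
    have "i < ?N" using ij by simp
    note c = cell[OF this] cell[OF ij(2)]
    have "0 \<le> real i * pi / real ?N" by simp
    then show "0 \<le> \<theta> i" using c by linarith
    have "(real i + 1) * pi / real ?N \<le> real j * pi / real ?N"
      using ij by (intro divide_right_mono mult_right_mono) auto
    then show "\<theta> i < \<theta> j" using c by linarith
    have "(real j + 1) * pi / real ?N \<le> real ?N * pi / real ?N"
      using ij by (intro divide_right_mono mult_right_mono) auto
    moreover have "real ?N * pi / real ?N = pi" using M_pos by simp
    ultimately show "\<theta> j \<le> pi" using c by linarith
  qed
  have \<mu>_less: "\<mu> i < \<mu> j" if "i < j" "j < ?N" for i j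
    using cos_less[OF that] \<rho> by (simp add: \<mu>_def)
  \<comment> \<open>With \<open>cos (\<theta> i) \<le> 1\<close> the eigenvalue is at least
    \<open>(1 - \<rho>)\<^sup>2\<close>.\<close>
  have \<mu>_pos: "0 < \<mu> i" for i
  proof -
    have "2 * \<rho> * cos (\<theta> i) \<le> 2 * \<rho>" using \<rho> by simp
    moreover have "0 < (1 - \<rho>)\<^sup>2" using \<rho> by simp
    ultimately show ?thesis unfolding \<mu>_def power2_eq_square by (simp add: algebra_simps)
  qed
  let ?D = "block_diag (s.T \<rho>) (a.T \<rho>)" and ?K = "interleave ?N * block_diag (Qs * DCT_II M) (Qa * DCT_IV M)"
  have B: "?B \<in> carrier_mat ?N ?N" and Bt: "transpose_mat ?B \<in> carrier_mat ?N ?N"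
    and T: "?T \<in> carrier_mat ?N ?N"
    by simp_all
  have BtB: "transpose_mat ?B * ?B = 1\<^sub>m ?N" by (rule orthogonal_transpose[OF B butterfly_orthogonal])
  have BT: "?B * ?T \<in> carrier_mat ?N ?N" by (rule mult_carrier_mat[OF B T])
  have D: "?D = ?B * ?T * transpose_mat ?B"
    unfolding butterfly_conj_tridiag[OF M_pos] s.T_eq a.T_eq by simp
  have "transpose_mat ?B * ?D * ?B = (transpose_mat ?B * (?B * ?T)) * (transpose_mat ?B * ?B)"
    unfolding D using B Bt BT mult_carrier_mat[OF BT Bt] mult_carrier_mat[OF Bt BT]
    by (simp only: assoc_mult_mat[of _ ?N ?N _ ?N _ ?N] mult_carrier_mat[of _ ?N ?N _ ?N])
  also have "\<dots> = transpose_mat ?B * (?B * ?T)"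
    unfolding BtB by (rule right_mult_one_mat[OF mult_carrier_mat[OF Bt BT]])
  also have "\<dots> = (transpose_mat ?B * ?B) * ?T" by (rule assoc_mult_mat[symmetric, OF Bt B T])
  also have "\<dots> = ?T" unfolding BtB by (rule left_mult_one_mat[OF T])
  finally have conj: "transpose_mat ?B * ?D * ?B = ?T" .
  have "eigenframe ?N ?D \<mu> ?K"
    unfolding \<mu>[symmetric]
    by (rule eigenframe_interleave[OF s.eigenframe_T[OF \<theta>s(2)] a.eigenframe_T[OF \<theta>a(2)]])
  then have "eigenframe ?N ?T \<mu> (fast_form M (Qs * DCT_II M) (Qa * DCT_IV M))"
    unfolding fast_form_def conj[symmetric] by (rule eigenframe_conj[OF _ B butterfly_orthogonal])
  then have "eigenframe ?N (AR1_cov ?N \<rho>) (\<lambda>i. (1 - \<rho>\<^sup>2) / \<mu> i)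
      (fast_form M (Qs * DCT_II M) (Qa * DCT_IV M))"
    by (rule eigenframe_inverse[OF _ AR1_precision AR1_cov_carrier(1) transpose_AR1_cov])
      (use \<mu>_pos in \<open>simp add: less_imp_neq[symmetric]\<close>)
  moreover have "(1 - \<rho>\<^sup>2) / \<mu> j < (1 - \<rho>\<^sup>2) / \<mu> i" if "i < j" "j < ?N" for i j
    using \<mu>_less[OF that] \<mu>_pos \<rho> by (intro divide_strict_left_mono) (auto simp: power_less_one_iff abs_square_less_1)
  ultimately show ?thesis by blast
qed

lemma is_KLT_iff:
  "is_KLT (2 * M) \<rho> W \<longleftrightarrow> (\<exists>\<nu>. eigenframe (2 * M) (AR1_cov (2 * M) \<rho>) \<nu> W \<and>
    (\<forall>i j. i < j \<and> j < 2 * M \<longrightarrow> \<nu> j \<le> \<nu> i))"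
  unfolding is_KLT_def ordered_eigenvector_mat_iff[OF AR1_cov_carrier(1) transpose_AR1_cov] by simp

lemma fast_form_is_KLT:
  assumes "0 < \<rho>" "\<rho> < 1"
    and "increasing_eigenvector_mat (G_s M \<rho>) Qs" "increasing_eigenvector_mat (G_a M \<rho>) Qa"
  shows "is_KLT (2 * M) \<rho> (fast_form M (Qs * DCT_II M) (Qa * DCT_IV M))"
proof -
  obtain \<nu> where "eigenframe (2 * M) (AR1_cov (2 * M) \<rho>) \<nu> (fast_form M (Qs * DCT_II M) (Qa * DCT_IV M))"
    "\<And>i j. i < j \<Longrightarrow> j < 2 * M \<Longrightarrow> \<nu> j < \<nu> i"
    using KLT_eigenframe[OF assms] by blast
  then show ?thesis unfolding is_KLT_iff by (meson less_imp_le)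
qed

text \<open>The fast form has a strictly decreasing spectrum and so acts as the reference frame;
  \<open>W\<close> need only be weakly ordered.\<close>

lemma KLT_factorization:
  assumes "0 < \<rho>" "\<rho> < 1"
    and "increasing_eigenvector_mat (G_s M \<rho>) Qs" "increasing_eigenvector_mat (G_a M \<rho>) Qa"
    and W: "is_KLT (2 * M) \<rho> W"
  shows "row_sign_eq W (fast_form M (Qs * DCT_II M) (Qa * DCT_IV M))"
proof -
  obtain \<nu> where \<nu>: "eigenframe (2 * M) (AR1_cov (2 * M) \<rho>) \<nu> (fast_form M (Qs * DCT_II M) (Qa * DCT_IV M))"
    "\<And>i j. i < j \<Longrightarrow> j < 2 * M \<Longrightarrow> \<nu> j < \<nu> i"
    using KLT_eigenframe[OF assms(1-4)] by blast
  obtain \<mu> where \<mu>: "eigenframe (2 * M) (AR1_cov (2 * M) \<rho>) \<mu> W"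
    "\<And>i j. i < j \<Longrightarrow> j < 2 * M \<Longrightarrow> \<mu> j \<le> \<mu> i"
    using W unfolding is_KLT_iff by blast
  show ?thesis
  proof (rule eigenframe_unique(1)[OF \<nu>(1) \<mu>(1), where ord = "(\<ge>)"])
    show "\<nu> i \<noteq> \<nu> j \<and> \<not> \<nu> i \<le> \<nu> j" if "i < j" "j < 2 * M" for i j
      using \<nu>(2)[OF that] by linarith
  qed (rule \<mu>(2))
qed

text \<open>Three choices of signs meet: \<open>\<kappa>\<close> relates the arbitrary family
  \<open>W\<close> to the factored form, while \<open>\<sigma>\<close> and \<open>\<tau>\<close>
  make the two branch matrices converge. The product \<open>\<eta>\<close> works because
  \<open>\<kappa>\<close> squares to 1 and branch signs pass through the interleaving.\<close>

lemma KLT_tendsto: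
  assumes W: "\<And>\<rho>. 0 < \<rho> \<Longrightarrow> \<rho> < 1 \<Longrightarrow> is_KLT (2 * M) \<rho> (W \<rho>)"
  shows "mat_tendsto_upto_row_signs W (fast_form M (DCT_II M) (DCT_IV M)) (at_left 1)"
proof -
  obtain Qs where Qs: "\<And>\<rho>. 0 < \<rho> \<Longrightarrow> \<rho> < 1 \<Longrightarrow> increasing_eigenvector_mat (G_s M \<rho>) (Qs \<rho>)"
    using s.increasing_exists unfolding s_eqs by metis
  obtain Qa where Qa: "\<And>\<rho>. 0 < \<rho> \<Longrightarrow> \<rho> < 1 \<Longrightarrow> increasing_eigenvector_mat (G_a M \<rho>) (Qa \<rho>)"
    using a.increasing_exists unfolding a_eqs by metis
  have Q_carrier: "Qs \<rho> \<in> carrier_mat M M" "Qa \<rho> \<in> carrier_mat M M" if "0 < \<rho>" "\<rho> < 1" for \<rho>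
    using Qs[OF that] Qa[OF that] s.G_carrier[of \<rho>] a.G_carrier[of \<rho>]
    unfolding ordered_eigenvector_mat_def s_eqs a_eqs by auto
  obtain \<sigma> where \<sigma>: "\<And>\<rho> i. \<sigma> \<rho> i \<in> {1, -1 :: real}"
    "mat_tendsto (\<lambda>\<rho>. mat_diag M (\<sigma> \<rho>) * Qs \<rho>) (1\<^sub>m M) (at_left 1)"
    using s.increasing_tendsto[of Qs] Qs unfolding s_eqs mat_tendsto_upto_row_signs_def by auto
  obtain \<tau> where \<tau>: "\<And>\<rho> i. \<tau> \<rho> i \<in> {1, -1 :: real}"
    "mat_tendsto (\<lambda>\<rho>. mat_diag M (\<tau> \<rho>) * Qa \<rho>) (1\<^sub>m M) (at_left 1)"
    using a.increasing_tendsto[of Qa] Qa unfolding a_eqs mat_tendsto_upto_row_signs_def by auto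
  let ?F = "\<lambda>\<rho>. fast_form M (Qs \<rho> * DCT_II M) (Qa \<rho> * DCT_IV M)"
  \<comment> \<open>Signs are required for every real \<open>\<rho>\<close>; outside the unit
    interval they are constantly 1.\<close>
  have "\<exists>\<kappa>. (\<forall>i. \<kappa> i \<in> {1, -1 :: real}) \<and> (0 < \<rho> \<and> \<rho> < 1 \<longrightarrow> W \<rho> = mat_diag (2 * M) \<kappa> * ?F \<rho>)" for \<rho>
  proof (cases "0 < \<rho> \<and> \<rho> < 1")
    case True
    have "row_sign_eq (W \<rho>) (?F \<rho>)" using KLT_factorization Qs Qa W True by blast
    moreover have "dim_row (?F \<rho>) = 2 * M"
      using True Q_carrier by (intro carrier_matD(1)[OF fast_form_carrier] mult_carrier_mat[OF _ DCT_carrier(1)]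
          mult_carrier_mat[OF _ DCT_carrier(2)]) auto
    ultimately show ?thesis unfolding row_sign_eq_def by auto
  qed (auto intro: exI[of _ "\<lambda>_. 1"])
  then obtain \<kappa> where \<kappa>: "\<And>\<rho> i. \<kappa> \<rho> i \<in> {1, -1 :: real}"
    "\<And>\<rho>. 0 < \<rho> \<Longrightarrow> \<rho> < 1 \<Longrightarrow> W \<rho> = mat_diag (2 * M) (\<kappa> \<rho>) * ?F \<rho>"
    by metis
  define \<eta> where "\<eta> \<rho> i = interleaved (\<sigma> \<rho>) (\<tau> \<rho>) i * \<kappa> \<rho> i" for \<rho> i
  have "\<eta> \<rho> i \<in> {1, -1}" for \<rho> i
    using \<sigma>(1)[of \<rho> "i div 2"] \<tau>(1)[of \<rho> "i div 2"] \<kappa>(1)[of \<rho> i] by (auto simp: \<eta>_def interleaved_def)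
  moreover have "mat_tendsto (\<lambda>\<rho>. mat_diag (2 * M) (\<eta> \<rho>) * W \<rho>) (fast_form M (DCT_II M) (DCT_IV M)) (at_left 1)"
  proof -
    let ?X = "\<lambda>\<rho>. fast_form M ((mat_diag M (\<sigma> \<rho>) * Qs \<rho>) * DCT_II M) ((mat_diag M (\<tau> \<rho>) * Qa \<rho>) * DCT_IV M)"
    have "mat_tendsto ?X (fast_form M (1\<^sub>m M * DCT_II M) (1\<^sub>m M * DCT_IV M)) (at_left 1)"
      by (intro fast_form_tendsto mat_tendsto_mult \<sigma>(2) \<tau>(2) mat_tendsto_const)
        (simp_all add: carrier_matD[OF DCT_carrier(1)] carrier_matD[OF DCT_carrier(2)])
    then have lim: "mat_tendsto ?X (fast_form M (DCT_II M) (DCT_IV M)) (at_left 1)"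
      by (simp add: left_mult_one_mat[OF DCT_carrier(1)] left_mult_one_mat[OF DCT_carrier(2)])
    have "\<forall>\<^sub>F \<rho> in at_left 1. ?X \<rho> = mat_diag (2 * M) (\<eta> \<rho>) * W \<rho>"
      using eventually_unit_interval
    proof eventually_elim
      case (elim \<rho>)
      then have Q: "Qs \<rho> \<in> carrier_mat M M" "Qa \<rho> \<in> carrier_mat M M" using Q_carrier by auto
      have QC: "Qs \<rho> * DCT_II M \<in> carrier_mat M M" "Qa \<rho> * DCT_IV M \<in> carrier_mat M M"
        by (rule mult_carrier_mat[OF Q(1) DCT_carrier(1)], rule mult_carrier_mat[OF Q(2) DCT_carrier(2)])
      have sq: "\<kappa> \<rho> i * \<kappa> \<rho> i = 1" for i using \<kappa>(1)[of \<rho> i] by auto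
      have "W \<rho> = mat_diag (2 * M) (\<kappa> \<rho>) * ?F \<rho>" using \<kappa>(2) elim by blast
      then have "mat_diag (2 * M) (\<eta> \<rho>) * W \<rho> =
          (mat_diag (2 * M) (\<eta> \<rho>) * mat_diag (2 * M) (\<kappa> \<rho>)) * ?F \<rho>"
        by (simp only: assoc_mult_mat[OF mat_diag_dim mat_diag_dim fast_form_carrier[OF QC]])
      also have "mat_diag (2 * M) (\<eta> \<rho>) * mat_diag (2 * M) (\<kappa> \<rho>) = mat_diag (2 * M) (interleaved (\<sigma> \<rho>) (\<tau> \<rho>))"
        by (simp add: \<eta>_def mult.assoc sq)
      also have "\<dots> * ?F \<rho> = ?X \<rho>"
        unfolding fast_form_signs[OF QC, symmetric]
          assoc_mult_mat[OF mat_diag_dim Q(1) DCT_carrier(1)] assoc_mult_mat[OF mat_diag_dim Q(2) DCT_carrier(2)] ..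
      finally show ?case by simp
    qed
    then have ev: "\<forall>\<^sub>F \<rho> in at_left 1. ?X \<rho> = mat_diag (2 * M) (\<eta> \<rho>) * W \<rho>" .
    have "\<forall>\<^sub>F \<rho> in at_left 1. mat_diag (2 * M) (\<eta> \<rho>) * W \<rho> \<in>
        carrier_mat (dim_row (fast_form M (DCT_II M) (DCT_IV M))) (dim_col (fast_form M (DCT_II M) (DCT_IV M)))"
      using ev lim[unfolded mat_tendsto_def, THEN conjunct1] by eventually_elim simp
    moreover have "((\<lambda>\<rho>. (mat_diag (2 * M) (\<eta> \<rho>) * W \<rho>) $$ (i, j)) \<longlongrightarrow>
        fast_form M (DCT_II M) (DCT_IV M) $$ (i, j)) (at_left 1)"
      if "i < dim_row (fast_form M (DCT_II M) (DCT_IV M))" "j < dim_col (fast_form M (DCT_II M) (DCT_IV M))" for i j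
    proof (rule Lim_transform_eventually)
      show "((\<lambda>\<rho>. ?X \<rho> $$ (i, j)) \<longlongrightarrow> fast_form M (DCT_II M) (DCT_IV M) $$ (i, j)) (at_left 1)"
        using lim that unfolding mat_tendsto_def by blast
      show "\<forall>\<^sub>F \<rho> in at_left 1. ?X \<rho> $$ (i, j) = (mat_diag (2 * M) (\<eta> \<rho>) * W \<rho>) $$ (i, j)"
        using ev by eventually_elim simp
    qed
    ultimately show ?thesis unfolding mat_tendsto_def by blast
  qed
  moreover have "dim_row (fast_form M (DCT_II M) (DCT_IV M)) = 2 * M"
    by (rule carrier_matD(1)[OF fast_form_carrier[OF DCT_carrier]])
  ultimately show ?thesis unfolding mat_tendsto_upto_row_signs_def by auto
qed

lemma fast_form_endpoint:
  assumes "increasing_eigenvector_mat (G_s M 1) Qs" "increasing_eigenvector_mat (G_a M 1) Qa"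
  shows "row_sign_eq (fast_form M (Qs * DCT_II M) (Qa * DCT_IV M)) (fast_form M (DCT_II M) (DCT_IV M))"
proof -
  have "row_sign_eq Qs (1\<^sub>m M)" "row_sign_eq Qa (1\<^sub>m M)"
    using assms s.increasing_G_1_iff a.increasing_G_1_iff unfolding s_eqs a_eqs by blast+
  then obtain \<sigma> \<tau> :: "nat \<Rightarrow> real" where \<sigma>: "\<forall>i. \<sigma> i \<in> {1, -1}" "Qs = mat_diag M \<sigma>"
    and \<tau>: "\<forall>i. \<tau> i \<in> {1, -1}" "Qa = mat_diag M \<tau>"
    unfolding row_sign_eq_def index_one_mat(2) right_mult_one_mat[OF mat_diag_dim] by blast
  have "\<forall>i. interleaved \<sigma> \<tau> i \<in> {1, -1}" using \<sigma>(1) \<tau>(1) by (simp add: interleaved_def)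
  moreover have "dim_row (fast_form M (DCT_II M) (DCT_IV M)) = 2 * M"
    by (rule carrier_matD(1)[OF fast_form_carrier[OF DCT_carrier]])
  ultimately show ?thesis
    unfolding row_sign_eq_def \<sigma>(2) \<tau>(2) fast_form_signs[OF DCT_carrier] by metis
qed

end

text \<open>The existence clauses keep the factorization from being vacuous. At
  \<open>\<rho> = 1\<close> the covariance is the all-ones matrix, whose eigenvalue 0 has
  multiplicity \<open>N - 1\<close>, so in general it does not single out the DCT. The endpoint is
  therefore expressed through \<open>G_s M 1\<close> and \<open>G_a M 1\<close>, and as the limit of
  every family of KLTs.\<close>

theorem corollary4p4:
  fixes N M :: nat
  assumes "even N" and "0 < N" and "M = N div 2"
  shows
    "(\<forall>\<rho>::real. 0 < \<rho> \<and> \<rho> < 1 \<longrightarrow>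
        butterfly N * T_mat N \<rho> * transpose_mat (butterfly N) = block_diag (T_s M \<rho>) (T_a M \<rho>) \<and>
        G_s M \<rho> = D_s M \<rho> + rank_one_term \<rho> (q_s M) \<and>
        G_a M \<rho> = D_a M \<rho> + rank_one_term \<rho> (q_a M) \<and>
        (\<exists>W. is_KLT N \<rho> W) \<and>
        (\<exists>Qs. increasing_eigenvector_mat (G_s M \<rho>) Qs) \<and>
        (\<exists>Qa. increasing_eigenvector_mat (G_a M \<rho>) Qa) \<and>
        (\<forall>W Qs Qa. is_KLT N \<rho> W \<and>
            increasing_eigenvector_mat (G_s M \<rho>) Qs \<and>
            increasing_eigenvector_mat (G_a M \<rho>) Qa \<longrightarrow>
            row_sign_eq W
              (interleave N * block_diag (Qs * DCT_II M) (Qa * DCT_IV M) * butterfly N))) \<and>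

     (mat_tendsto (\<lambda>\<rho>. rank_one_term \<rho> (unit_vec M 0)) (0\<^sub>m M M) (at_left 1) \<and>
      mat_tendsto (\<lambda>\<rho>. rank_one_term \<rho> (q_s M)) (0\<^sub>m M M) (at_left 1) \<and>
      mat_tendsto (\<lambda>\<rho>. rank_one_term \<rho> (q_a M)) (0\<^sub>m M M) (at_left 1)) \<and>

     (mat_tendsto (D_s M) (Lambda_II M) (at_left 1) \<and> D_s M 1 = Lambda_II M \<and>
      mat_tendsto (D_a M) (Lambda_IV M) (at_left 1) \<and> D_a M 1 = Lambda_IV M \<and>
      diagonal_mat (Lambda_II M) \<and> sorted_wrt (<) (diag_mat (Lambda_II M)) \<and>
      diagonal_mat (Lambda_IV M) \<and> sorted_wrt (<) (diag_mat (Lambda_IV M)) \<and>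
      (\<forall>Qs. increasing_eigenvector_mat (G_s M 1) Qs \<longleftrightarrow> row_sign_eq Qs (1\<^sub>m M)) \<and>
      (\<forall>Qa. increasing_eigenvector_mat (G_a M 1) Qa \<longleftrightarrow> row_sign_eq Qa (1\<^sub>m M)) \<and>
      (\<forall>Qs. (\<forall>\<rho>. 0 < \<rho> \<and> \<rho> < 1 \<longrightarrow> increasing_eigenvector_mat (G_s M \<rho>) (Qs \<rho>)) \<longrightarrow>
          mat_tendsto_upto_row_signs Qs (1\<^sub>m M) (at_left (1::real))) \<and>
      (\<forall>Qa. (\<forall>\<rho>. 0 < \<rho> \<and> \<rho> < 1 \<longrightarrow> increasing_eigenvector_mat (G_a M \<rho>) (Qa \<rho>)) \<longrightarrow>
          mat_tendsto_upto_row_signs Qa (1\<^sub>m M) (at_left (1::real)))) \<and>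

     ((\<forall>Qs Qa. increasing_eigenvector_mat (G_s M 1) Qs \<and>
            increasing_eigenvector_mat (G_a M 1) Qa \<longrightarrow>
          row_sign_eq
            (interleave N * block_diag (Qs * DCT_II M) (Qa * DCT_IV M) * butterfly N)
            (interleave N * block_diag (DCT_II M) (DCT_IV M) * butterfly N)) \<and>
      (\<forall>W. (\<forall>\<rho>. 0 < \<rho> \<and> \<rho> < 1 \<longrightarrow> is_KLT N \<rho> (W \<rho>)) \<longrightarrow>
          mat_tendsto_upto_row_signs W
            (interleave N * block_diag (DCT_II M) (DCT_IV M) * butterfly N) (at_left (1::real))) \<and>
      DCT_II N = interleave N * block_diag (DCT_II M) (DCT_IV M) * butterfly N)"
proof -
  have M: "0 < M" and N: "N = 2 * M" using assms by auto
  interpret dct_branches M by unfold_locales (rule M)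
  note fast = fast_form_def[of M, symmetric]
  show ?thesis
    unfolding N fast
  proof (intro conjI allI impI; (elim conjE)?)
    fix \<rho> :: real assume \<rho>: "0 < \<rho>" "\<rho> < 1"
    show "butterfly (2 * M) * T_mat (2 * M) \<rho> * transpose_mat (butterfly (2 * M)) =
        block_diag (T_s M \<rho>) (T_a M \<rho>)"
      by (rule butterfly_conj_T_mat[OF \<rho>])
    show "G_s M \<rho> = D_s M \<rho> + rank_one_term \<rho> (q_s M)" by (rule s.G_eq[unfolded s_eqs])
    show "G_a M \<rho> = D_a M \<rho> + rank_one_term \<rho> (q_a M)" by (rule a.G_eq[unfolded a_eqs])
    show Qs: "\<exists>Qs. increasing_eigenvector_mat (G_s M \<rho>) Qs"
      by (rule s.increasing_exists[OF \<rho>, unfolded s_eqs])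
    show Qa: "\<exists>Qa. increasing_eigenvector_mat (G_a M \<rho>) Qa"
      by (rule a.increasing_exists[OF \<rho>, unfolded a_eqs])
    show "\<exists>W. is_KLT (2 * M) \<rho> W" using fast_form_is_KLT[OF \<rho>] Qs Qa by blast
    show "row_sign_eq W (fast_form M (Qs * DCT_II M) (Qa * DCT_IV M))"
      if "is_KLT (2 * M) \<rho> W" "increasing_eigenvector_mat (G_s M \<rho>) Qs"
        "increasing_eigenvector_mat (G_a M \<rho>) Qa" for W Qs Qa
      by (rule KLT_factorization[OF \<rho> that(2,3,1)])
  next
    show "mat_tendsto (\<lambda>\<rho>. rank_one_term \<rho> (unit_vec M 0)) (0\<^sub>m M M) (at_left 1)"
      by (rule rank_one_term_tendsto) simp
    show "mat_tendsto (\<lambda>\<rho>. rank_one_term \<rho> (q_s M)) (0\<^sub>m M M) (at_left 1)"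
      by (rule rank_one_term_tendsto[OF s.q_carrier[unfolded s_eqs]])
    show "mat_tendsto (\<lambda>\<rho>. rank_one_term \<rho> (q_a M)) (0\<^sub>m M M) (at_left 1)"
      by (rule rank_one_term_tendsto[OF a.q_carrier[unfolded a_eqs]])
  next
    show "mat_tendsto (D_s M) (Lambda_II M) (at_left 1)"
      using s.D_tendsto unfolding s_eqs s_eqs(4)[abs_def] .
    show "mat_tendsto (D_a M) (Lambda_IV M) (at_left 1)"
      using a.D_tendsto unfolding a_eqs a_eqs(4)[abs_def] .
    show "D_s M 1 = Lambda_II M" by (rule s.D_1[unfolded s_eqs])
    show "D_a M 1 = Lambda_IV M" by (rule a.D_1[unfolded a_eqs])
    show "diagonal_mat (Lambda_II M)" by (rule s.diagonal_\<Lambda>[unfolded s_eqs])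
    show "diagonal_mat (Lambda_IV M)" by (rule a.diagonal_\<Lambda>[unfolded a_eqs])
    show "sorted_wrt (<) (diag_mat (Lambda_II M))" by (rule s.sorted_\<Lambda>[unfolded s_eqs])
    show "sorted_wrt (<) (diag_mat (Lambda_IV M))" by (rule a.sorted_\<Lambda>[unfolded a_eqs])
    show "increasing_eigenvector_mat (G_s M 1) Q \<longleftrightarrow> row_sign_eq Q (1\<^sub>m M)" for Q
      by (rule s.increasing_G_1_iff[unfolded s_eqs])
    show "increasing_eigenvector_mat (G_a M 1) Q \<longleftrightarrow> row_sign_eq Q (1\<^sub>m M)" for Q
      by (rule a.increasing_G_1_iff[unfolded a_eqs])
    show "mat_tendsto_upto_row_signs Q (1\<^sub>m M) (at_left 1)"
      if "\<forall>\<rho>. 0 < \<rho> \<and> \<rho> < 1 \<longrightarrow> increasing_eigenvector_mat (G_s M \<rho>) (Q \<rho>)" for Q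
      by (rule s.increasing_tendsto[unfolded s_eqs]) (use that in blast)
    show "mat_tendsto_upto_row_signs Q (1\<^sub>m M) (at_left 1)"
      if "\<forall>\<rho>. 0 < \<rho> \<and> \<rho> < 1 \<longrightarrow> increasing_eigenvector_mat (G_a M \<rho>) (Q \<rho>)" for Q
      by (rule a.increasing_tendsto[unfolded a_eqs]) (use that in blast)
  next
    show "row_sign_eq (fast_form M (Qs * DCT_II M) (Qa * DCT_IV M)) (fast_form M (DCT_II M) (DCT_IV M))"
      if "increasing_eigenvector_mat (G_s M 1) Qs" "increasing_eigenvector_mat (G_a M 1) Qa" for Qs Qa
      by (rule fast_form_endpoint[OF that])
    show "mat_tendsto_upto_row_signs W (fast_form M (DCT_II M) (DCT_IV M)) (at_left 1)"
      if "\<forall>\<rho>. 0 < \<rho> \<and> \<rho> < 1 \<longrightarrow> is_KLT (2 * M) \<rho> (W \<rho>)" for W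
      by (rule KLT_tendsto) (use that in blast)
    show "DCT_II (2 * M) = fast_form M (DCT_II M) (DCT_IV M)"
      unfolding fast_form_def by (rule DCT_II_factorization[OF M])
  qed
qed

end
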